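(* Let $G$ and $H$ be groups, and let $m$ and $n$ be positive integers. Then $\mathrm M^{\oplus}_m(G^{\sqcup0})$ embeds, as a bias, into $\mathrm M^{\oplus}_n(H^{\sqcup0})$, if and only if $m\le n$ and $G$ embeds, as a subgroup, into the wreath product $H\wr\mathfrak S_{\lfloor n/m\rfloor}$.
   Context: A semigroup $S$ is inverse if every $x\in S$ has a unique $x^{-1}$ with $x=xx^{-1}x$ and $x^{-1}=x^{-1}xx^{-1}$. The natural ordering is $x\le y$ iff $x=yx^{-1}x$. In an inverse semigroup with zero, $x,y$ are orthogonal if $x^{-1}y=xy^{-1}=0$. A Boolean inverse semigroup is an inverse semigroup with zero whose idempotents form a generalized Boolean algebra and in which any two orthogonal $x,y$ have a join $x\oplus y$ for the natural ordering. A bias is the same as a Boolean inverse semigroup; bias homomorphisms are exactly the semigroup homomorphisms $f$ with $f(0)=0$ and $f(x\oplus y)=f(x)\oplus f(y)$ for orthogonal $x,y$ (units need not be preserved). "Embeds as a bias" means that there is a one-to-one bias homomorphism. For a positive integer $n$ and a Boolean inverse semigroup $S$, a generalized rook matrix of order $n$ over $S$ is a matrix $(x_{i,j})_{1\le i,j\le n}$ over $S$ with $x_{i,j}^{-1}x_{i,k}=x_{j,i}x_{k,i}^{-1}=0$ whenever $j\ne k$; these form a Boolean inverse semigroup $\mathrm M^{\oplus}_n(S)$ under $(xy)_{i,j}=\bigoplus_kx_{i,k}y_{k,j}$. For a group $G$, $G^{\sqcup0}=G\cup\{0\}$ is $G$ with a new zero. $H\wr\mathfrak S_k=H^k\rtimes\mathfrak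 S_k$, where the symmetric group $\mathfrak S_k$ permutes the coordinates. $\lfloor x\rfloor$ is the largest integer $\le x$. *)

theory Defs
  imports
    "HOL-Algebra.Lattice"
    "HOL-Algebra.Sym_Groups"
    "HOL-Algebra.Product_Groups"
    "Jordan_Normal_Form.Matrix"
begin

section \<open>Boolean inverse semigroups\<close>

record 'a semigroup0 = "'a partial_object" +
  sprod :: "['a, 'a] \<Rightarrow> 'a" (infixl \<open>\<star>\<index>\<close> 70)
  szero :: 'a (\<open>\<^bold>0\<index>\<close>)

definition sinv :: "('a, 'b) semigroup0_scheme \<Rightarrow> 'a \<Rightarrow> 'a" (\<open>sinv\<index> _\<close> [81] 80) where
  "sinv\<^bsub>S\<^esub> x = (THE y. y \<in> carrier S \<and> x = x \<star>\<^bsub>S\<^esub> y \<star>\<^bsub>S\<^esub> x \<and> y = y \<star>\<^bsub>S\<^esub> x \<star>\<^bsub>S\<^esub> y)"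

locale inverse_semigroup0 =
  fixes S (structure)
  assumes sprod_closed: "\<lbrakk>x \<in> carrier S; y \<in> carrier S\<rbrakk> \<Longrightarrow> x \<star> y \<in> carrier S"
    and sprod_assoc:
      "\<lbrakk>x \<in> carrier S; y \<in> carrier S; z \<in> carrier S\<rbrakk> \<Longrightarrow> x \<star> y \<star> z = x \<star> (y \<star> z)"
    and unique_inverse:
      "x \<in> carrier S \<Longrightarrow> \<exists>!y. y \<in> carrier S \<and> x = x \<star> y \<star> x \<and> y = y \<star> x \<star> y"
    and szero_closed: "\<^bold>0 \<in> carrier S"
    and szero_left: "x \<in> carrier S \<Longrightarrow> \<^bold>0 \<star> x = \<^bold>0"
    and szero_right: "x \<in> carrier S \<Longrightarrow> x \<star> \<^bold>0 = \<^bold>0"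

definition natural_order :: "('a, 'b) semigroup0_scheme \<Rightarrow> 'a gorder" where
  "natural_order S =
     \<lparr>carrier = carrier S, eq = (=), le = (\<lambda>x y. x = y \<star>\<^bsub>S\<^esub> sinv\<^bsub>S\<^esub> x \<star>\<^bsub>S\<^esub> x)\<rparr>"

definition orthogonal :: "('a, 'b) semigroup0_scheme \<Rightarrow> 'a \<Rightarrow> 'a \<Rightarrow> bool" where
  "orthogonal S x y \<longleftrightarrow>
     sinv\<^bsub>S\<^esub> x \<star>\<^bsub>S\<^esub> y = \<^bold>0\<^bsub>S\<^esub> \<and> x \<star>\<^bsub>S\<^esub> sinv\<^bsub>S\<^esub> y = \<^bold>0\<^bsub>S\<^esub>"

definition idempotents :: "('a, 'b) semigroup0_scheme \<Rightarrow> 'a set" where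
  "idempotents S = {e \<in> carrier S. e \<star>\<^bsub>S\<^esub> e = e}"

text \<open>A generalized Boolean algebra is a distributive lattice with a least element
  in which every principal ideal is complemented; a greatest element is not required.\<close>

locale generalized_boolean_algebra = lattice + weak_partial_order_bottom +
  assumes meet_join_distrib:
      "\<lbrakk>x \<in> carrier L; y \<in> carrier L; z \<in> carrier L\<rbrakk>
        \<Longrightarrow> x \<sqinter> (y \<squnion> z) = (x \<sqinter> y) \<squnion> (x \<sqinter> z)"
    and relative_complement:
      "\<lbrakk>x \<in> carrier L; y \<in> carrier L; x \<sqsubseteq> y\<rbrakk>
        \<Longrightarrow> \<exists>z \<in> carrier L. x \<sqinter> z = \<bottom> \<and> x \<squnion> z = y"

locale boolean_inverse_semigroup = inverse_semigroup0 +
  assumes idempotents_boolean: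
      "generalized_boolean_algebra ((natural_order S)\<lparr>carrier := idempotents S\<rparr>)"
    and orthogonal_join_exists:
      "\<lbrakk>x \<in> carrier S; y \<in> carrier S; orthogonal S x y\<rbrakk>
        \<Longrightarrow> \<exists>z. is_lub (natural_order S) z {x, y}"

text \<open>The orthogonal sum of \<open>x\<close> and \<open>y\<close> is their join for the natural ordering. Bias
  homomorphisms need not preserve a unit.\<close>

locale bias_hom = S?: boolean_inverse_semigroup S + T?: boolean_inverse_semigroup T
  for S (structure) and T (structure) +
  fixes f
  assumes hom_closed: "x \<in> carrier S \<Longrightarrow> f x \<in> carrier T"
    and hom_sprod:
      "\<lbrakk>x \<in> carrier S; y \<in> carrier S\<rbrakk> \<Longrightarrow> f (x \<star>\<^bsub>S\<^esub> y) = f x \<star>\<^bsub>T\<^esub> f y"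
    and hom_szero: "f \<^bold>0\<^bsub>S\<^esub> = \<^bold>0\<^bsub>T\<^esub>"
    and hom_orthogonal_join:
      "\<lbrakk>x \<in> carrier S; y \<in> carrier S; orthogonal S x y\<rbrakk>
        \<Longrightarrow> f (x \<squnion>\<^bsub>natural_order S\<^esub> y) = f x \<squnion>\<^bsub>natural_order T\<^esub> f y"

definition embeds_as_bias ::
    "('a, 'c) semigroup0_scheme \<Rightarrow> ('b, 'd) semigroup0_scheme \<Rightarrow> bool" where
  "embeds_as_bias S T \<longleftrightarrow> (\<exists>f. bias_hom S T f \<and> inj_on f (carrier S))"


section \<open>Generalized rook matrices\<close>

definition rook_matrices :: "nat \<Rightarrow> ('a, 'b) semigroup0_scheme \<Rightarrow> 'a mat set" where
  "rook_matrices n S = {x \<in> carrier_mat n n. elements_mat x \<subseteq> carrier S \<and>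
     (\<forall>i<n. \<forall>j<n. \<forall>k<n. j \<noteq> k \<longrightarrow>
        sinv\<^bsub>S\<^esub> (x $$ (i, j)) \<star>\<^bsub>S\<^esub> x $$ (i, k) = \<^bold>0\<^bsub>S\<^esub> \<and>
        x $$ (j, i) \<star>\<^bsub>S\<^esub> sinv\<^bsub>S\<^esub> (x $$ (k, i)) = \<^bold>0\<^bsub>S\<^esub>)}"

text \<open>The orthogonal sum defining an entry of a product is the join, for the natural
  ordering of \<open>S\<close>, of its finitely many summands.\<close>

definition rook_semigroup :: "nat \<Rightarrow> ('a, 'b) semigroup0_scheme \<Rightarrow> 'a mat semigroup0" where
  "rook_semigroup n S =
     \<lparr>carrier = rook_matrices n S,
      sprod = (\<lambda>x y. mat n n (\<lambda>(i, j).
        \<Squnion>\<^bsub>natural_order S\<^esub> {x $$ (i, k) \<star>\<^bsub>S\<^esub> y $$ (k, j) |k. k < n})),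
      szero = mat n n (\<lambda>_. \<^bold>0\<^bsub>S\<^esub>)\<rparr>"


section \<open>Groups with zero and wreath products\<close>

text \<open>The new zero is \<open>None\<close>.\<close>

definition group_with_zero :: "('a, 'b) monoid_scheme \<Rightarrow> 'a option semigroup0" where
  "group_with_zero G =
     \<lparr>carrier = insert None (Some ` carrier G),
      sprod = (\<lambda>x y. case (x, y) of (Some g, Some h) \<Rightarrow> Some (g \<otimes>\<^bsub>G\<^esub> h) | _ \<Rightarrow> None),
      szero = None\<rparr>"

definition semidirect_product ::
    "('a, 'c) monoid_scheme \<Rightarrow> ('b, 'd) monoid_scheme \<Rightarrow> ('b \<Rightarrow> 'a \<Rightarrow> 'a) \<Rightarrow> ('a \<times> 'b) monoid" where
  "semidirect_product N K \<phi> =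
     \<lparr>carrier = carrier N \<times> carrier K,
      mult = (\<lambda>(a, s) (b, t). (a \<otimes>\<^bsub>N\<^esub> \<phi> s b, s \<otimes>\<^bsub>K\<^esub> t)),
      one = (\<one>\<^bsub>N\<^esub>, \<one>\<^bsub>K\<^esub>)\<rparr>"

text \<open>A permutation moves the \<open>i\<close>-th coordinate to position \<open>\<sigma> i\<close>; the inverse makes this a
  left action, as multiplication in \<^const>\<open>sym_group\<close> is composition of functions.\<close>

definition wreath_product :: "('a, 'b) monoid_scheme \<Rightarrow> nat \<Rightarrow> ((nat \<Rightarrow> 'a) \<times> (nat \<Rightarrow> nat)) monoid" where
  "wreath_product H k =
     semidirect_product (product_group {1..k} (\<lambda>_. H)) (sym_group k)
       (\<lambda>\<sigma> h. \<lambda>i\<in>{1..k}. h (inv' \<sigma> i))"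

end

theory Submission
  imports Defs
begin

text \<open>
  An element of the rook matrix semigroup over a group with zero is a matrix with at most one
  nonzero entry in each row and column. It is therefore a partial bijection of the index set whose
  arrows \<open>(i, g, j)\<close> carry labels in the group; call such a set of arrows a chart. In terms of charts
  the product is labelled composition, the inverse is the reversed chart, the natural ordering is
  inclusion, orthogonality is disjointness of both domains and ranges, the join of two orthogonal
  elements is the union, and the idempotents are the partial identities. This makes it plain that
  rook matrices form a Boolean inverse semigroup (the locale \<open>chart_semigroup\<close>), and it turns the
  theorem into a statement about sets of arrows.

  The link with wreath products is that \<open>H \<wr> \<SS>\<^sub>k\<close> is the group of everywhere defined charts over \<open>H\<close> on
  \<open>k\<close> indices: \<open>(h, \<sigma>)\<close> is the monomial matrix with entry \<open>h a\<close> in position \<open>(a, \<sigma>\<inverse> a)\<close>. Hence an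
  embedding of \<open>G\<close> into \<open>H \<wr> \<SS>\<^sub>k\<close> is a faithful monomial representation of \<open>G\<close> over \<open>H\<close> of degree \<open>k\<close>
  (\<open>mon_wreath_product_iff\<close>).

  If such a representation \<open>W\<close> is given and \<open>m k \<le> n\<close>, replace each entry \<open>g\<close> of a rook matrix of
  order \<open>m\<close> by the \<open>k \<times> k\<close> block \<open>W g\<close>. This respects products and unions and is injective
  (\<open>embeds_as_bias_if_monomial_rep\<close>). The floor of \<open>n / m\<close> is the largest \<open>k\<close> with \<open>m k \<le> n\<close>, and it is
  positive exactly when \<open>m \<le> n\<close>.

  Conversely, an embedding sends the diagonal matrix units to nonzero pairwise orthogonal
  idempotents, that is, to the partial identities of nonempty disjoint subsets \<open>A\<^sub>0, \<dots>, A\<^sub>m\<^sub>-\<^sub>1\<close> of the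
  \<open>n\<close> indices. The image of the matrix unit in position \<open>(0, i)\<close> is a labelled bijection between \<open>A\<^sub>0\<close>
  and \<open>A\<^sub>i\<close>, so all these sets have the same size \<open>l\<close>, and \<open>m l \<le> n\<close>. The image of the corner
  consisting of the matrices with a single entry at \<open>(0, 0)\<close> is a faithful monomial representation
  of \<open>G\<close> on \<open>A\<^sub>0\<close> (\<open>monomial_rep_if_chart_embedding\<close>). Its degree \<open>l\<close> may be smaller than the floor of
  \<open>n / m\<close>; adding trivial summands repairs this (\<open>monomial_rep_extend\<close>).
\<close>

section \<open>Charts over a group\<close>

text \<open>
  The triple \<open>(i, g, j)\<close> stands for the entry \<open>g\<close> in row \<open>i\<close> and column \<open>j\<close>, so that a chart
  is a partial monomial matrix.
\<close>
definition charts :: "('g, 'c) monoid_scheme \<Rightarrow> 'i set \<Rightarrow> ('i \<times> 'g \<times> 'i) set set" where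
  "charts G I = {X. X \<subseteq> I \<times> carrier G \<times> I \<and>
     (\<forall>i g j h k. (i, g, j) \<in> X \<longrightarrow> (i, h, k) \<in> X \<longrightarrow> g = h \<and> j = k) \<and>
     (\<forall>i g j h k. (j, g, i) \<in> X \<longrightarrow> (k, h, i) \<in> X \<longrightarrow> g = h \<and> j = k)}"

definition chart_mult ::
    "('g, 'c) monoid_scheme \<Rightarrow> ('i \<times> 'g \<times> 'i) set \<Rightarrow> ('i \<times> 'g \<times> 'i) set \<Rightarrow> ('i \<times> 'g \<times> 'i) set"
    (infixl \<open>\<diamondop>\<index>\<close> 70) where
  "X \<diamondop>\<^bsub>G\<^esub> Y = {(i, g \<otimes>\<^bsub>G\<^esub> h, j) | i g k h j. (i, g, k) \<in> X \<and> (k, h, j) \<in> Y}"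

definition chart_inv ::
    "('g, 'c) monoid_scheme \<Rightarrow> ('i \<times> 'g \<times> 'i) set \<Rightarrow> ('i \<times> 'g \<times> 'i) set" where
  "chart_inv G X = {(j, inv\<^bsub>G\<^esub> g, i) | i g j. (i, g, j) \<in> X}"

definition unit_chart :: "('g, 'c) monoid_scheme \<Rightarrow> 'i set \<Rightarrow> ('i \<times> 'g \<times> 'i) set" where
  "unit_chart G A = {(i, \<one>\<^bsub>G\<^esub>, i) | i. i \<in> A}"

definition row_set :: "('i \<times> 'g \<times> 'i) set \<Rightarrow> 'i set" where
  "row_set X = fst ` X"

definition col_set :: "('i \<times> 'g \<times> 'i) set \<Rightarrow> 'i set" where
  "col_set X = (snd \<circ> snd) ` X"

lemma in_rows_iff: "i \<in> row_set X \<longleftrightarrow> (\<exists>g j. (i, g, j) \<in> X)"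
  unfolding row_set_def image_iff by force

lemma in_cols_iff: "j \<in> col_set X \<longleftrightarrow> (\<exists>i g. (i, g, j) \<in> X)"
  unfolding col_set_def image_iff by force

lemma chartsI:
  assumes "\<And>i g j. (i, g, j) \<in> X \<Longrightarrow> i \<in> I \<and> g \<in> carrier G \<and> j \<in> I"
    and "\<And>i g j h k. \<lbrakk>(i, g, j) \<in> X; (i, h, k) \<in> X\<rbrakk> \<Longrightarrow> g = h \<and> j = k"
    and "\<And>i g j h k. \<lbrakk>(j, g, i) \<in> X; (k, h, i) \<in> X\<rbrakk> \<Longrightarrow> g = h \<and> j = k"
  shows "X \<in> charts G I"
  using assms unfolding charts_def by fast

lemma chart_carrier:
  assumes "X \<in> charts G I" and "(i, g, j) \<in> X"
  shows "i \<in> I" "g \<in> carrier G" "j \<in> I"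
  using assms unfolding charts_def by blast+

lemma chart_row:
  assumes "X \<in> charts G I" and "(i, g, j) \<in> X" and "(i, h, k) \<in> X"
  shows "g = h" "j = k"
  using assms unfolding charts_def by blast+

lemma chart_col:
  assumes "X \<in> charts G I" and "(j, g, i) \<in> X" and "(k, h, i) \<in> X"
  shows "g = h" "j = k"
  using assms unfolding charts_def by blast+

lemma empty_chart: "{} \<in> charts G I"
  by (simp add: charts_def)

lemma chart_mult_empty [simp]: "{} \<diamondop>\<^bsub>G\<^esub> X = {}" "X \<diamondop>\<^bsub>G\<^esub> {} = {}"
  by (auto simp: chart_mult_def)

lemma chart_multI: "\<lbrakk>(i, g, k) \<in> X; (k, h, j) \<in> Y\<rbrakk> \<Longrightarrow> (i, g \<otimes>\<^bsub>G\<^esub> h, j) \<in> X \<diamondop>\<^bsub>G\<^esub> Y"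
  by (auto simp: chart_mult_def)

lemma chart_multE:
  assumes "(i, u, j) \<in> X \<diamondop>\<^bsub>G\<^esub> Y"
  obtains g k h where "u = g \<otimes>\<^bsub>G\<^esub> h" "(i, g, k) \<in> X" "(k, h, j) \<in> Y"
  using assms by (auto simp: chart_mult_def)

lemma chart_inv_iff: "(j, u, i) \<in> chart_inv G X \<longleftrightarrow> (\<exists>g. u = inv\<^bsub>G\<^esub> g \<and> (i, g, j) \<in> X)"
  by (auto simp: chart_inv_def)

lemma unit_chart_iff: "(i, g, j) \<in> unit_chart G A \<longleftrightarrow> i \<in> A \<and> g = \<one>\<^bsub>G\<^esub> \<and> j = i"
  by (auto simp: unit_chart_def)

lemma charts_Un:
  assumes X: "X \<in> charts G I" and Y: "Y \<in> charts G I"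
    and "row_set X \<inter> row_set Y = {}" "col_set X \<inter> col_set Y = {}"
  shows "X \<union> Y \<in> charts G I"
proof (rule chartsI)
  fix i g j assume "(i, g, j) \<in> X \<union> Y"
  then show "i \<in> I \<and> g \<in> carrier G \<and> j \<in> I"
    using chart_carrier[OF X, of i g j] chart_carrier[OF Y, of i g j] by auto
next
  fix i g j h k assume *: "(i, g, j) \<in> X \<union> Y" "(i, h, k) \<in> X \<union> Y"
  then have "\<not> (i \<in> row_set X \<and> i \<in> row_set Y)"
    using assms(3) by auto
  then show "g = h \<and> j = k"
    using * chart_row[OF X, of i g j h k] chart_row[OF Y, of i g j h k] by (auto simp: in_rows_iff)
next
  fix i g j h k assume *: "(j, g, i) \<in> X \<union> Y" "(k, h, i) \<in> X \<union> Y"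
  then have "\<not> (i \<in> col_set X \<and> i \<in> col_set Y)"
    using assms(4) by auto
  then show "g = h \<and> j = k"
    using * chart_col[OF X, of j g i k h] chart_col[OF Y, of j g i k h] by (auto simp: in_cols_iff)
qed

lemma card_rows_eq_card_cols:
  assumes "X \<in> charts G I"
  shows "card (row_set X) = card (col_set X)"
proof -
  have "inj_on fst X"
    by (rule inj_onI) (metis assms chart_row prod.collapse)
  moreover have "inj_on (snd \<circ> snd) X"
    by (rule inj_onI) (metis assms chart_col comp_apply prod.collapse)
  ultimately show ?thesis
    by (metis card_image col_set_def row_set_def)
qed

lemma rows_mult_subset: "row_set (X \<diamondop>\<^bsub>G\<^esub> Y) \<subseteq> row_set X"
  and cols_mult_subset: "col_set (X \<diamondop>\<^bsub>G\<^esub> Y) \<subseteq> col_set Y"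
  by (auto simp: in_rows_iff in_cols_iff elim!: chart_multE) blast+

lemma rows_unit_chart [simp]: "row_set (unit_chart G A) = A"
  and cols_unit_chart [simp]: "col_set (unit_chart G A) = A"
  by (auto simp: in_rows_iff in_cols_iff unit_chart_iff)

lemma unit_chart_Un: "unit_chart G A \<union> unit_chart G B = unit_chart G (A \<union> B)"
  and unit_chart_Int: "unit_chart G A \<inter> unit_chart G B = unit_chart G (A \<inter> B)"
  and unit_chart_Diff: "unit_chart G A - unit_chart G B = unit_chart G (A - B)"
  and unit_chart_empty: "unit_chart G {} = {}"
  by (auto simp: unit_chart_def)

context group
begin

lemma chart_mult_closed:
  assumes X: "X \<in> charts G I" and Y: "Y \<in> charts G I"
  shows "X \<diamondop> Y \<in> charts G I"
proof (rule chartsI)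
  fix i u j v k
  assume "(i, u, j) \<in> X \<diamondop> Y"
  then show "i \<in> I \<and> u \<in> carrier G \<and> j \<in> I"
    by (elim chart_multE) (use chart_carrier[OF X] chart_carrier[OF Y] in auto)
next
  fix i u j v k
  assume "(i, u, j) \<in> X \<diamondop> Y" "(i, v, k) \<in> X \<diamondop> Y"
  then show "u = v \<and> j = k"
    by (elim chart_multE) (metis chart_row[OF X] chart_row[OF Y])
next
  fix i u j v k
  assume "(j, u, i) \<in> X \<diamondop> Y" "(k, v, i) \<in> X \<diamondop> Y"
  then show "u = v \<and> j = k"
    by (elim chart_multE) (metis chart_col[OF X] chart_col[OF Y])
qed

lemma chart_mult_assoc:
  assumes X: "X \<in> charts G I" and Y: "Y \<in> charts G I" and Z: "Z \<in> charts G I"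
  shows "X \<diamondop> Y \<diamondop> Z = X \<diamondop> (Y \<diamondop> Z)"
proof -
  have a: "g \<otimes> h \<otimes> w = g \<otimes> (h \<otimes> w)" if "(i, g, j) \<in> X" "(j, h, k) \<in> Y" "(k, w, l) \<in> Z"
    for i j k l g h w
    using that by (simp add: m_assoc chart_carrier[OF X] chart_carrier[OF Y] chart_carrier[OF Z])
  show ?thesis
  proof (intro equalityI subrelI; clarify)
    fix i u j assume "(i, u, j) \<in> X \<diamondop> Y \<diamondop> Z"
    then obtain g k h l w where "u = g \<otimes> h \<otimes> w"
      and m: "(i, g, k) \<in> X" "(k, h, l) \<in> Y" "(l, w, j) \<in> Z"
      by (elim chart_multE) blast
    then show "(i, u, j) \<in> X \<diamondop> (Y \<diamondop> Z)"
      using chart_multI[OF m(1) chart_multI[OF m(2,3)], of G G] a[OF m] by simp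
  next
    fix i u j assume "(i, u, j) \<in> X \<diamondop> (Y \<diamondop> Z)"
    then obtain g k h l w where "u = g \<otimes> (h \<otimes> w)"
      and m: "(i, g, k) \<in> X" "(k, h, l) \<in> Y" "(l, w, j) \<in> Z"
      by (elim chart_multE) blast
    then show "(i, u, j) \<in> X \<diamondop> Y \<diamondop> Z"
      using chart_multI[OF chart_multI[OF m(1,2)] m(3), of G G] a[OF m] by simp
  qed
qed

lemma chart_inv_closed:
  assumes "X \<in> charts G I"
  shows "chart_inv G X \<in> charts G I"
proof (rule chartsI)
  fix i u j assume "(i, u, j) \<in> chart_inv G X"
  then show "i \<in> I \<and> u \<in> carrier G \<and> j \<in> I"
    using chart_carrier[OF assms] by (auto simp: chart_inv_iff)
next
  fix i u j v k assume "(i, u, j) \<in> chart_inv G X" "(i, v, k) \<in> chart_inv G X"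
  then show "u = v \<and> j = k"
    unfolding chart_inv_iff using chart_col[OF assms] by metis
next
  fix i u j v k assume "(j, u, i) \<in> chart_inv G X" "(k, v, i) \<in> chart_inv G X"
  then show "u = v \<and> j = k"
    unfolding chart_inv_iff using chart_row[OF assms] by metis
qed

lemma chart_inv_inv:
  assumes "X \<in> charts G I"
  shows "chart_inv G (chart_inv G X) = X"
proof (intro equalityI subrelI; clarify)
  fix i u j assume "(i, u, j) \<in> chart_inv G (chart_inv G X)"
  then show "(i, u, j) \<in> X"
    using chart_carrier(2)[OF assms] by (auto simp: chart_inv_iff)
next
  fix i u j assume "(i, u, j) \<in> X"
  then show "(i, u, j) \<in> chart_inv G (chart_inv G X)"
    using chart_carrier(2)[OF assms] unfolding chart_inv_iff by (metis inv_inv)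
qed

text \<open>
  Composing a chart with its reverse returns along the same arrow, because a chart has at most one
  arrow into each index and at most one out of it.
\<close>
lemma mult_inv_chart:
  assumes "X \<in> charts G I"
  shows "X \<diamondop> chart_inv G X = unit_chart G (row_set X)"
    and "chart_inv G X \<diamondop> X = unit_chart G (col_set X)"
proof -
  have [simp]: "g \<otimes> inv g = \<one>" "inv g \<otimes> g = \<one>" if "(i, g, j) \<in> X" for i g j
    using chart_carrier(2)[OF assms that] by simp_all
  show "X \<diamondop> chart_inv G X = unit_chart G (row_set X)"
  proof (intro equalityI subrelI; clarify)
    fix i u j assume "(i, u, j) \<in> X \<diamondop> chart_inv G X"
    then obtain g k h where "u = g \<otimes> inv h" "(i, g, k) \<in> X" "(j, h, k) \<in> X"
      by (elim chart_multE) (auto simp: chart_inv_iff)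
    then show "(i, u, j) \<in> unit_chart G (row_set X)"
      using chart_col[OF assms, of i g k j h] by (auto simp: unit_chart_iff in_rows_iff)
  next
    fix i u j assume "(i, u, j) \<in> unit_chart G (row_set X)"
    then obtain g k where "u = \<one>" "j = i" and g: "(i, g, k) \<in> X"
      by (auto simp: unit_chart_iff in_rows_iff)
    moreover have "(k, inv g, i) \<in> chart_inv G X"
      using g by (auto simp: chart_inv_iff)
    ultimately show "(i, u, j) \<in> X \<diamondop> chart_inv G X"
      using chart_multI[OF g, of "inv g" i "chart_inv G X" G] by simp
  qed
  show "chart_inv G X \<diamondop> X = unit_chart G (col_set X)"
  proof (intro equalityI subrelI; clarify)
    fix i u j assume "(i, u, j) \<in> chart_inv G X \<diamondop> X"
    then obtain g k h where "u = inv g \<otimes> h" "(k, g, i) \<in> X" "(k, h, j) \<in> X"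
      by (elim chart_multE) (auto simp: chart_inv_iff)
    then show "(i, u, j) \<in> unit_chart G (col_set X)"
      using chart_row[OF assms, of k g i h j] by (auto simp: unit_chart_iff in_cols_iff)
  next
    fix i u j assume "(i, u, j) \<in> unit_chart G (col_set X)"
    then obtain g k where "u = \<one>" "j = i" and g: "(k, g, i) \<in> X"
      by (auto simp: unit_chart_iff in_cols_iff)
    moreover have "(i, inv g, k) \<in> chart_inv G X"
      using g by (auto simp: chart_inv_iff)
    ultimately show "(i, u, j) \<in> chart_inv G X \<diamondop> X"
      using chart_multI[OF _ g, of i "inv g" "chart_inv G X" G] by simp
  qed
qed

lemma mult_unit_chart:
  assumes "X \<in> charts G I"
  shows "X \<diamondop> unit_chart G A = {(i, g, j) \<in> X. j \<in> A}"
    and "unit_chart G A \<diamondop> X = {(i, g, j) \<in> X. i \<in> A}"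
proof -
  have [simp]: "g \<otimes> \<one> = g" "\<one> \<otimes> g = g" if "(i, g, j) \<in> X" for i g j
    using chart_carrier(2)[OF assms that] by simp_all
  show "X \<diamondop> unit_chart G A = {(i, g, j) \<in> X. j \<in> A}"
    by (force simp: chart_mult_def unit_chart_iff)
  show "unit_chart G A \<diamondop> X = {(i, g, j) \<in> X. i \<in> A}"
    by (force simp: chart_mult_def unit_chart_iff)
qed

lemma chart_mult_inv_mult: 
  assumes "X \<in> charts G I"
  shows "X \<diamondop> chart_inv G X \<diamondop> X = X"
  by (auto simp: mult_inv_chart[OF assms] mult_unit_chart[OF assms] in_rows_iff)

text \<open>
  An arrow of \<open>Y = Y X Y\<close> factors through arrows of \<open>Y\<close>, \<open>X\<close> and \<open>Y\<close>. The outer two start or end where the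
  given arrow does, so both coincide with it, and the middle one must be its reverse.
\<close>
lemma chart_inverse_subset:
  assumes X: "X \<in> charts G I" and Y: "Y \<in> charts G I" and eq: "Y \<diamondop> X \<diamondop> Y = Y"
  shows "Y \<subseteq> chart_inv G X"
proof (intro subrelI; clarify)
  fix k h l assume *: "(k, h, l) \<in> Y"
  then have "(k, h, l) \<in> Y \<diamondop> X \<diamondop> Y"
    by (simp add: eq)
  then obtain h1 i g j h2 where h: "h = h1 \<otimes> g \<otimes> h2"
    and Y1: "(k, h1, i) \<in> Y" and Xg: "(i, g, j) \<in> X" and Y2: "(j, h2, l) \<in> Y"
    by (elim chart_multE) blast
  have [simp]: "h1 = h" "i = l" "h2 = h" "j = k"
    using chart_row[OF Y * Y1] chart_col[OF Y * Y2] by simp_all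
  have c: "h \<in> carrier G" "g \<in> carrier G"
    using chart_carrier(2)[OF Y *] chart_carrier(2)[OF X Xg] by simp_all
  then have "h = inv g"
    using h by (metis \<open>h1 = h\<close> \<open>h2 = h\<close> inv_equality inv_inv m_closed r_cancel_one' )
  then show "(k, h, l) \<in> chart_inv G X"
    using Xg by (auto simp: chart_inv_iff)
qed

lemma chart_inv_mono: "X \<subseteq> Y \<Longrightarrow> chart_inv G X \<subseteq> chart_inv G Y"
  by (auto simp: chart_inv_def)

lemma chart_inverse_unique:
  assumes X: "X \<in> charts G I" and Y: "Y \<in> charts G I"
    and "X \<diamondop> Y \<diamondop> X = X" "Y \<diamondop> X \<diamondop> Y = Y"
  shows "Y = chart_inv G X"
  using chart_inverse_subset[OF X Y assms(4)]
    chart_inv_mono[OF chart_inverse_subset[OF Y X assms(3)]] chart_inv_inv[OF Y] by auto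

text \<open>
  The right-hand side of the equation is \<open>Y\<close> restricted to the columns of \<open>X\<close>. A subset of a chart is
  recovered from its columns in this way.
\<close>
lemma chart_order_iff:
  assumes X: "X \<in> charts G I" and Y: "Y \<in> charts G I"
  shows "X = Y \<diamondop> chart_inv G X \<diamondop> X \<longleftrightarrow> X \<subseteq> Y"
proof -
  have "Y \<diamondop> chart_inv G X \<diamondop> X = Y \<diamondop> (chart_inv G X \<diamondop> X)"
    by (rule chart_mult_assoc[OF Y chart_inv_closed[OF X] X])
  also have "\<dots> = {(i, g, j) \<in> Y. j \<in> col_set X}"
    by (simp add: mult_inv_chart(2)[OF X] mult_unit_chart(1)[OF Y])
  finally have *: "Y \<diamondop> chart_inv G X \<diamondop> X = {(i, g, j) \<in> Y. j \<in> col_set X}" .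
  show ?thesis
    unfolding *
  proof
    assume "X \<subseteq> Y"
    show "X = {(i, g, j) \<in> Y. j \<in> col_set X}"
    proof (intro equalityI subrelI; clarify)
      fix i g j assume "(i, g, j) \<in> X"
      then show "(i, g, j) \<in> Y \<and> j \<in> col_set X"
        using \<open>X \<subseteq> Y\<close> by (auto simp: in_cols_iff)
    next
      fix i g j assume "(i, g, j) \<in> Y" "j \<in> col_set X"
      then obtain k h where "(k, h, j) \<in> X"
        by (auto simp: in_cols_iff)
      then show "(i, g, j) \<in> X"
        using \<open>X \<subseteq> Y\<close> chart_col[OF Y \<open>(i, g, j) \<in> Y\<close>, of k h] by auto
    qed
  next
    assume eq: "X = {(i, g, j) \<in> Y. j \<in> col_set X}"
    show "X \<subseteq> Y"
      by (subst eq) auto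
  qed
qed

lemma chart_orthogonal_iff:
  shows "chart_inv G X \<diamondop> Y = {} \<longleftrightarrow> row_set X \<inter> row_set Y = {}"
    and "X \<diamondop> chart_inv G Y = {} \<longleftrightarrow> col_set X \<inter> col_set Y = {}"
  by (auto simp: set_eq_iff chart_mult_def chart_inv_iff in_rows_iff in_cols_iff) blast+

text \<open>
  If \<open>X X = X\<close>, an arrow of \<open>X\<close> factors into two arrows of \<open>X\<close>; each of them shares an endpoint with the
  given one and so equals it. The arrow is thus a loop whose label is its own square.
\<close>
lemma idempotent_chart_iff:
  assumes X: "X \<in> charts G I"
  shows "X \<diamondop> X = X \<longleftrightarrow> X = unit_chart G (row_set X)"
proof
  assume eq: "X \<diamondop> X = X"
  have "g = \<one> \<and> j = i" if *: "(i, g, j) \<in> X" for i g j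
  proof -
    obtain g1 k g2 where g: "g = g1 \<otimes> g2" and 1: "(i, g1, k) \<in> X" and 2: "(k, g2, j) \<in> X"
      using * eq by (metis chart_multE)
    show ?thesis
      using chart_row[OF X * 1] chart_col[OF X * 2] chart_carrier(2)[OF X *] g
      by (metis r_cancel_one')
  qed
  then show "X = unit_chart G (row_set X)"
    unfolding unit_chart_def by (auto simp: in_rows_iff)
next
  let ?U = "unit_chart G (row_set X)"
  have "?U \<diamondop> ?U = ?U"
    unfolding chart_mult_def unit_chart_def by auto
  moreover assume "X = ?U"
  ultimately show "X \<diamondop> X = X"
    by metis
qed

lemma unit_chart_closed: "A \<subseteq> I \<Longrightarrow> unit_chart G A \<in> charts G I"
  by (rule chartsI) (auto simp: unit_chart_iff)

end

text \<open>
  An order isomorphic to a family of sets that contains the empty set and is closed under union,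
  intersection and difference inherits the lattice laws from those of sets. This is applied to the
  idempotents, which correspond to the subsets of the index set.
\<close>
lemma ring_of_sets_generalized_boolean_algebra:
  fixes L :: "('a, 'b) gorder_scheme"
  assumes eq: "eq L = (=)"
    and inj: "inj_on c (carrier L)"
    and le: "\<And>x y. \<lbrakk>x \<in> carrier L; y \<in> carrier L\<rbrakk> \<Longrightarrow> x \<sqsubseteq>\<^bsub>L\<^esub> y \<longleftrightarrow> c x \<subseteq> c y"
    and empty: "{} \<in> c ` carrier L"
    and Un: "\<And>A B. \<lbrakk>A \<in> c ` carrier L; B \<in> c ` carrier L\<rbrakk> \<Longrightarrow> A \<union> B \<in> c ` carrier L"
    and Int: "\<And>A B. \<lbrakk>A \<in> c ` carrier L; B \<in> c ` carrier L\<rbrakk> \<Longrightarrow> A \<inter> B \<in> c ` carrier L"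
    and Diff: "\<And>A B. \<lbrakk>A \<in> c ` carrier L; B \<in> c ` carrier L\<rbrakk> \<Longrightarrow> A - B \<in> c ` carrier L"
  shows "generalized_boolean_algebra L"
proof -
  interpret partial_order L
    by unfold_locales (use eq le in \<open>auto dest: inj_onD[OF inj]\<close>)
  have lub: "is_lub L z {x, y}"
    if xyz: "x \<in> carrier L" "y \<in> carrier L" "z \<in> carrier L" "c z = c x \<union> c y" for x y z
  proof (rule least_UpperI)
    fix w assume "w \<in> {x, y}"
    then show "w \<sqsubseteq>\<^bsub>L\<^esub> z" using xyz by (auto simp: le)
  next
    fix w assume "w \<in> Upper L {x, y}"
    then have "w \<in> carrier L" "x \<sqsubseteq>\<^bsub>L\<^esub> w" "y \<sqsubseteq>\<^bsub>L\<^esub> w"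
      using xyz by (simp_all add: Upper_def)
    then show "z \<sqsubseteq>\<^bsub>L\<^esub> w" using xyz by (simp add: le)
  qed (use xyz in auto)
  have glb: "is_glb L z {x, y}"
    if xyz: "x \<in> carrier L" "y \<in> carrier L" "z \<in> carrier L" "c z = c x \<inter> c y" for x y z
  proof (rule greatest_LowerI)
    fix w assume "w \<in> {x, y}"
    then show "z \<sqsubseteq>\<^bsub>L\<^esub> w" using xyz by (auto simp: le)
  next
    fix w assume "w \<in> Lower L {x, y}"
    then have "w \<in> carrier L" "w \<sqsubseteq>\<^bsub>L\<^esub> x" "w \<sqsubseteq>\<^bsub>L\<^esub> y"
      using xyz by (simp_all add: Lower_def)
    then show "w \<sqsubseteq>\<^bsub>L\<^esub> z" using xyz by (simp add: le)
  qed (use xyz in auto)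
  have exU: "\<exists>z\<in>carrier L. c z = c x \<union> c y" if "x \<in> carrier L" "y \<in> carrier L" for x y
    using Un[OF imageI[OF that(1)] imageI[OF that(2)]] by (metis imageE)
  have exI: "\<exists>z\<in>carrier L. c z = c x \<inter> c y" if "x \<in> carrier L" "y \<in> carrier L" for x y
    using Int[OF imageI[OF that(1)] imageI[OF that(2)]] by (metis imageE)
  have exD: "\<exists>z\<in>carrier L. c z = c x - c y" if "x \<in> carrier L" "y \<in> carrier L" for x y
    using Diff[OF imageI[OF that(1)] imageI[OF that(2)]] by (metis imageE)
  interpret lattice L
    by unfold_locales (metis lub exU, metis glb exI)
  obtain b where b: "b \<in> carrier L" "c b = {}"
    using empty by auto
  then have least_b: "least L b (carrier L)"
    by (auto simp: least_def le)
  interpret weak_partial_order_bottom L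
    by unfold_locales (use least_b in blast)
  have bot: "c \<bottom>\<^bsub>L\<^esub> = {}"
    using bottom_lower[OF b(1)] b le bottom_closed by auto
  have join: "c (x \<squnion>\<^bsub>L\<^esub> y) = c x \<union> c y" if xy: "x \<in> carrier L" "y \<in> carrier L" for x y
  proof -
    obtain z where "z \<in> carrier L" "c z = c x \<union> c y" using exU[OF xy] by blast
    then show ?thesis
      using lub[OF xy] least_unique sup_of_two_least[OF xy] by (metis join_def)
  qed
  have meet: "c (x \<sqinter>\<^bsub>L\<^esub> y) = c x \<inter> c y" if xy: "x \<in> carrier L" "y \<in> carrier L" for x y
  proof -
    obtain z where "z \<in> carrier L" "c z = c x \<inter> c y" using exI[OF xy] by blast
    then show ?thesis
      using glb[OF xy] greatest_unique inf_of_two_greatest[OF xy] by (metis meet_def)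
  qed
  show ?thesis
  proof unfold_locales
    fix x y z assume "x \<in> carrier L" "y \<in> carrier L" "z \<in> carrier L"
    then show "x \<sqinter>\<^bsub>L\<^esub> (y \<squnion>\<^bsub>L\<^esub> z) = x \<sqinter>\<^bsub>L\<^esub> y \<squnion>\<^bsub>L\<^esub> x \<sqinter>\<^bsub>L\<^esub> z"
      by (intro inj_onD[OF inj]) (auto simp: join meet)
  next
    fix x y assume xy: "x \<in> carrier L" "y \<in> carrier L" "x \<sqsubseteq>\<^bsub>L\<^esub> y"
    then obtain z where "z \<in> carrier L" "c z = c y - c x" using exD by blast
    then show "\<exists>z\<in>carrier L. x \<sqinter>\<^bsub>L\<^esub> z = \<bottom>\<^bsub>L\<^esub> \<and> x \<squnion>\<^bsub>L\<^esub> z = y"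
      using xy by (intro bexI[of _ z] conjI inj_onD[OF inj]) (auto simp: join meet bot le)
  qed
qed

section \<open>Semigroups presented by charts\<close>

text \<open>
  A semigroup with zero identified with the charts on \<open>I\<close> by \<open>c\<close>. Working with an abstract \<open>S\<close> separates
  the Boolean inverse semigroup structure, which is about sets of arrows, from matrices and
  suprema of entries.
\<close>
locale chart_semigroup = group G for G (structure) +
  fixes S :: "('s, 't) semigroup0_scheme" and I :: "'i set" and c :: "'s \<Rightarrow> ('i \<times> 'a \<times> 'i) set"
  assumes chart_bij: "bij_betw c (carrier S) (charts G I)"
    and prod_closed: "\<lbrakk>x \<in> carrier S; y \<in> carrier S\<rbrakk> \<Longrightarrow> x \<star>\<^bsub>S\<^esub> y \<in> carrier S"
    and chart_prod: "\<lbrakk>x \<in> carrier S; y \<in> carrier S\<rbrakk> \<Longrightarrow> c (x \<star>\<^bsub>S\<^esub> y) = c x \<diamondop> c y"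
    and zero_closed: "\<^bold>0\<^bsub>S\<^esub> \<in> carrier S"
    and chart_zero: "c \<^bold>0\<^bsub>S\<^esub> = {}"
begin

lemma chart_closed: "x \<in> carrier S \<Longrightarrow> c x \<in> charts G I"
  using chart_bij by (rule bij_betw_apply)

lemma chart_inject: "\<lbrakk>x \<in> carrier S; y \<in> carrier S\<rbrakk> \<Longrightarrow> c x = c y \<longleftrightarrow> x = y"
  using bij_betw_imp_inj_on[OF chart_bij] by (rule inj_on_eq_iff)

definition of_chart :: "('i \<times> 'a \<times> 'i) set \<Rightarrow> 's" where
  "of_chart = inv_into (carrier S) c"

lemma of_chart_closed: "X \<in> charts G I \<Longrightarrow> of_chart X \<in> carrier S"
  unfolding of_chart_def using chart_bij by (metis bij_betw_imp_surj_on inv_into_into)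

lemma chart_of_chart: "X \<in> charts G I \<Longrightarrow> c (of_chart X) = X"
  unfolding of_chart_def using chart_bij by (rule bij_betw_inv_into_right)

lemma of_chart_chart: "x \<in> carrier S \<Longrightarrow> of_chart (c x) = x"
  unfolding of_chart_def using chart_bij by (rule bij_betw_inv_into_left)

lemma is_inverse_iff:
  assumes x: "x \<in> carrier S" and y: "y \<in> carrier S"
  shows "x = x \<star>\<^bsub>S\<^esub> y \<star>\<^bsub>S\<^esub> x \<and> y = y \<star>\<^bsub>S\<^esub> x \<star>\<^bsub>S\<^esub> y \<longleftrightarrow> c y = chart_inv G (c x)"
proof -
  note X = chart_closed[OF x] and Y = chart_closed[OF y]
  have "x = x \<star>\<^bsub>S\<^esub> y \<star>\<^bsub>S\<^esub> x \<longleftrightarrow> c x \<diamondop> c y \<diamondop> c x = c x"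
    "y = y \<star>\<^bsub>S\<^esub> x \<star>\<^bsub>S\<^esub> y \<longleftrightarrow> c y \<diamondop> c x \<diamondop> c y = c y"
    using x y chart_inject[of x "x \<star>\<^bsub>S\<^esub> y \<star>\<^bsub>S\<^esub> x"] chart_inject[of y "y \<star>\<^bsub>S\<^esub> x \<star>\<^bsub>S\<^esub> y"]
    by (auto simp: chart_prod prod_closed)
  moreover have "c y = chart_inv G (c x)" if "c x \<diamondop> c y \<diamondop> c x = c x" "c y \<diamondop> c x \<diamondop> c y = c y"
    using chart_inverse_unique[OF X Y that] .
  moreover have "c x \<diamondop> c y \<diamondop> c x = c x" "c y \<diamondop> c x \<diamondop> c y = c y" if "c y = chart_inv G (c x)"
    using chart_mult_inv_mult[OF X] chart_mult_inv_mult[OF chart_inv_closed[OF X]]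
    by (simp_all add: that chart_inv_inv[OF X])
  ultimately show ?thesis
    by blast
qed

lemma chart_sinv:
  assumes x: "x \<in> carrier S"
  shows "sinv\<^bsub>S\<^esub> x \<in> carrier S" and "c (sinv\<^bsub>S\<^esub> x) = chart_inv G (c x)"
proof -
  let ?y = "of_chart (chart_inv G (c x))"
  have y: "?y \<in> carrier S" "c ?y = chart_inv G (c x)"
    by (simp_all add: of_chart_closed chart_of_chart chart_inv_closed chart_closed x)
  have "sinv\<^bsub>S\<^esub> x = ?y"
    unfolding sinv_def
  proof (rule the_equality)
    show "?y \<in> carrier S \<and> x = x \<star>\<^bsub>S\<^esub> ?y \<star>\<^bsub>S\<^esub> x \<and> ?y = ?y \<star>\<^bsub>S\<^esub> x \<star>\<^bsub>S\<^esub> ?y"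
      using y is_inverse_iff[OF x y(1)] by blast
  next
    fix z assume "z \<in> carrier S \<and> x = x \<star>\<^bsub>S\<^esub> z \<star>\<^bsub>S\<^esub> x \<and> z = z \<star>\<^bsub>S\<^esub> x \<star>\<^bsub>S\<^esub> z"
    then show "z = ?y"
      using is_inverse_iff[OF x, of z] y chart_inject[of z ?y] by simp
  qed
  with y show "sinv\<^bsub>S\<^esub> x \<in> carrier S" "c (sinv\<^bsub>S\<^esub> x) = chart_inv G (c x)"
    by simp_all
qed

text \<open>
  With the inverse identified as the reversed chart, the equation that defines the natural ordering
  is the one of \<open>chart_order_iff\<close>.
\<close>
lemma natural_order_iff:
  assumes "x \<in> carrier S" "y \<in> carrier S"
  shows "x \<sqsubseteq>\<^bsub>natural_order S\<^esub> y \<longleftrightarrow> c x \<subseteq> c y"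
proof -
  have "x \<sqsubseteq>\<^bsub>natural_order S\<^esub> y \<longleftrightarrow> c x = c (y \<star>\<^bsub>S\<^esub> sinv\<^bsub>S\<^esub> x \<star>\<^bsub>S\<^esub> x)"
    using assms by (simp add: natural_order_def chart_inject prod_closed chart_sinv)
  also have "\<dots> \<longleftrightarrow> c x = c y \<diamondop> chart_inv G (c x) \<diamondop> c x"
    using assms by (simp add: chart_prod prod_closed chart_sinv)
  also have "\<dots> \<longleftrightarrow> c x \<subseteq> c y"
    by (rule chart_order_iff[OF chart_closed[OF assms(1)] chart_closed[OF assms(2)]])
  finally show ?thesis .
qed

lemma orthogonal_iff:
  assumes "x \<in> carrier S" "y \<in> carrier S"
  shows "orthogonal S x y \<longleftrightarrow> row_set (c x) \<inter> row_set (c y) = {} \<and> col_set (c x) \<inter> col_set (c y) = {}"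
proof -
  have "orthogonal S x y \<longleftrightarrow> c (sinv\<^bsub>S\<^esub> x \<star>\<^bsub>S\<^esub> y) = {} \<and> c (x \<star>\<^bsub>S\<^esub> sinv\<^bsub>S\<^esub> y) = {}"
    unfolding orthogonal_def using assms
    by (simp add: chart_inject prod_closed chart_sinv zero_closed flip: chart_zero)
  then show ?thesis
    using assms by (simp add: chart_prod chart_sinv chart_orthogonal_iff)
qed

text \<open>
  Orthogonality makes the union of the two charts a chart.
\<close>
lemma orthogonal_is_lub:
  assumes x: "x \<in> carrier S" and y: "y \<in> carrier S" and "orthogonal S x y"
  shows "is_lub (natural_order S) (of_chart (c x \<union> c y)) {x, y}"
proof -
  let ?z = "of_chart (c x \<union> c y)"
  have "c x \<union> c y \<in> charts G I"
    using assms by (intro charts_Un chart_closed) (auto simp: orthogonal_iff)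
  then have z: "?z \<in> carrier S" "c ?z = c x \<union> c y"
    by (simp_all add: of_chart_closed chart_of_chart)
  have [simp]: "carrier (natural_order S) = carrier S"
    by (simp add: natural_order_def)
  show ?thesis
  proof (rule least_UpperI)
    fix w assume "w \<in> {x, y}"
    then show "w \<sqsubseteq>\<^bsub>natural_order S\<^esub> ?z"
      using x y z by (auto simp: natural_order_iff)
  next
    fix w assume "w \<in> Upper (natural_order S) {x, y}"
    then have "w \<in> carrier S" "x \<sqsubseteq>\<^bsub>natural_order S\<^esub> w" "y \<sqsubseteq>\<^bsub>natural_order S\<^esub> w"
      using x y by (simp_all add: Upper_def)
    then show "?z \<sqsubseteq>\<^bsub>natural_order S\<^esub> w"
      using x y z by (simp add: natural_order_iff)
  qed (use x y z in simp_all)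
qed

lemma chart_join:
  assumes x: "x \<in> carrier S" and y: "y \<in> carrier S" and o: "orthogonal S x y"
  shows "x \<squnion>\<^bsub>natural_order S\<^esub> y \<in> carrier S"
    and "c (x \<squnion>\<^bsub>natural_order S\<^esub> y) = c x \<union> c y"
proof -
  let ?z = "of_chart (c x \<union> c y)"
  note lub = orthogonal_is_lub[OF assms]
  have carr: "w \<in> carrier S" if "is_lub (natural_order S) w {x, y}" for w
    using least_closed[OF that] by (simp add: natural_order_def)
  have uniq: "w = ?z" if w: "is_lub (natural_order S) w {x, y}" for w
    using carr[OF w] carr[OF lub] least_le[OF w least_mem[OF lub]] least_le[OF lub least_mem[OF w]]
    by (simp add: natural_order_iff flip: chart_inject)
  have "x \<squnion>\<^bsub>natural_order S\<^esub> y = ?z"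
    unfolding join_def sup_def
    by (rule some_equality[where P = "\<lambda>w. is_lub (natural_order S) w {x, y}", OF lub uniq])
  moreover have "c x \<union> c y \<in> charts G I"
    using assms by (intro charts_Un chart_closed) (auto simp: orthogonal_iff)
  ultimately show "x \<squnion>\<^bsub>natural_order S\<^esub> y \<in> carrier S" "c (x \<squnion>\<^bsub>natural_order S\<^esub> y) = c x \<union> c y"
    by (simp_all add: of_chart_closed chart_of_chart)
qed

lemma charts_of_idempotents: "c ` idempotents S = unit_chart G ` Pow I"
proof (intro equalityI subsetI)
  fix X assume "X \<in> c ` idempotents S"
  then obtain e where e: "e \<in> carrier S" "e \<star>\<^bsub>S\<^esub> e = e" "X = c e"
    by (auto simp: idempotents_def)
  then have X: "X \<in> charts G I" and "X \<diamondop> X = X"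
    using chart_closed chart_prod[of e e] by simp_all
  then have "X = unit_chart G (row_set X)"
    by (simp add: idempotent_chart_iff)
  moreover have "row_set X \<subseteq> I"
    using chart_carrier(1)[OF X] by (auto simp: in_rows_iff)
  ultimately show "X \<in> unit_chart G ` Pow I"
    by blast
next
  fix X assume "X \<in> unit_chart G ` Pow I"
  then obtain A where A: "A \<subseteq> I" "X = unit_chart G A"
    by auto
  then have X: "X \<in> charts G I" "X \<diamondop> X = X"
    using unit_chart_closed[of A I] by (simp_all add: idempotent_chart_iff)
  let ?e = "of_chart X"
  have e: "?e \<in> carrier S" "c ?e = X"
    using X by (simp_all add: of_chart_closed chart_of_chart)
  then have "?e \<star>\<^bsub>S\<^esub> ?e = ?e"
    using X by (simp add: chart_prod prod_closed flip: chart_inject)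
  with e show "X \<in> c ` idempotents S"
    by (intro image_eqI[of _ _ ?e]) (simp_all add: idempotents_def)
qed

lemma idempotents_generalized_boolean_algebra:
  "generalized_boolean_algebra ((natural_order S)\<lparr>carrier := idempotents S\<rparr>)"
proof (rule ring_of_sets_generalized_boolean_algebra[where c = c])
  have sub: "idempotents S \<subseteq> carrier S"
    by (auto simp: idempotents_def)
  then show "inj_on c (carrier ((natural_order S)\<lparr>carrier := idempotents S\<rparr>))"
    using bij_betw_imp_inj_on[OF chart_bij] by (simp add: inj_on_subset)
  show "x \<sqsubseteq>\<^bsub>(natural_order S)\<lparr>carrier := idempotents S\<rparr>\<^esub> y \<longleftrightarrow> c x \<subseteq> c y"
    if "x \<in> carrier ((natural_order S)\<lparr>carrier := idempotents S\<rparr>)"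
      "y \<in> carrier ((natural_order S)\<lparr>carrier := idempotents S\<rparr>)" for x y
    using natural_order_iff[of x y] that sub by auto
  show "{} \<in> c ` carrier ((natural_order S)\<lparr>carrier := idempotents S\<rparr>)"
    by (auto simp: charts_of_idempotents unit_chart_empty intro!: image_eqI[where x = "{}"])
qed (auto simp: natural_order_def charts_of_idempotents unit_chart_Un unit_chart_Int unit_chart_Diff
      intro!: imageI)

sublocale boolean: boolean_inverse_semigroup S
proof (intro boolean_inverse_semigroup.intro inverse_semigroup0.intro
    boolean_inverse_semigroup_axioms.intro)
  fix x assume x: "x \<in> carrier S"
  show "\<exists>!y. y \<in> carrier S \<and> x = x \<star>\<^bsub>S\<^esub> y \<star>\<^bsub>S\<^esub> x \<and> y = y \<star>\<^bsub>S\<^esub> x \<star>\<^bsub>S\<^esub> y"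
  proof (rule ex1I)
    show "sinv\<^bsub>S\<^esub> x \<in> carrier S \<and> x = x \<star>\<^bsub>S\<^esub> sinv\<^bsub>S\<^esub> x \<star>\<^bsub>S\<^esub> x \<and> sinv\<^bsub>S\<^esub> x = sinv\<^bsub>S\<^esub> x \<star>\<^bsub>S\<^esub> x \<star>\<^bsub>S\<^esub> sinv\<^bsub>S\<^esub> x"
      using chart_sinv[OF x] is_inverse_iff[OF x, of "sinv\<^bsub>S\<^esub> x"] by blast
  next
    fix y assume "y \<in> carrier S \<and> x = x \<star>\<^bsub>S\<^esub> y \<star>\<^bsub>S\<^esub> x \<and> y = y \<star>\<^bsub>S\<^esub> x \<star>\<^bsub>S\<^esub> y"
    then show "y = sinv\<^bsub>S\<^esub> x"
      using is_inverse_iff[OF x, of y] chart_sinv[OF x] chart_inject[of y "sinv\<^bsub>S\<^esub> x"] by simp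
  qed
next
  fix x y z assume xyz: "x \<in> carrier S" "y \<in> carrier S" "z \<in> carrier S"
  then show "x \<star>\<^bsub>S\<^esub> y \<star>\<^bsub>S\<^esub> z = x \<star>\<^bsub>S\<^esub> (y \<star>\<^bsub>S\<^esub> z)"
    using chart_mult_assoc[OF xyz[THEN chart_closed]]
    by (simp add: prod_closed chart_prod flip: chart_inject)
next
  fix x y assume "x \<in> carrier S" "y \<in> carrier S" "orthogonal S x y"
  then show "\<exists>z. is_lub (natural_order S) z {x, y}"
    using orthogonal_is_lub by blast
qed (simp_all add: prod_closed zero_closed idempotents_generalized_boolean_algebra
      chart_prod chart_zero flip: chart_inject)

end

section \<open>Rook matrices over a group with zero\<close>

definition matrix_chart :: "nat \<Rightarrow> 'g option mat \<Rightarrow> (nat \<times> 'g \<times> nat) set" where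
  "matrix_chart n x = {(i, g, j). i < n \<and> j < n \<and> x $$ (i, j) = Some g}"

text \<open>
  The inverse of \<open>matrix_chart\<close> on charts; the description operator is applied only where the entry
  exists, and there it is unique.
\<close>
definition chart_matrix :: "nat \<Rightarrow> (nat \<times> 'g \<times> nat) set \<Rightarrow> 'g option mat" where
  "chart_matrix n X = mat n n (\<lambda>(i, j).
     if \<exists>g. (i, g, j) \<in> X then Some (THE g. (i, g, j) \<in> X) else None)"

lemma matrix_chart_iff: "(i, g, j) \<in> matrix_chart n x \<longleftrightarrow> i < n \<and> j < n \<and> x $$ (i, j) = Some g"
  by (simp add: matrix_chart_def)

context group
begin

abbreviation G0 :: "'a option semigroup0" where "G0 \<equiv> group_with_zero G"

lemma zero_G0: "\<^bold>0\<^bsub>G0\<^esub> = None"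
  by (simp add: group_with_zero_def)

lemma prod_G0:
  "Some g \<star>\<^bsub>G0\<^esub> Some h = Some (g \<otimes> h)" "None \<star>\<^bsub>G0\<^esub> a = None" "a \<star>\<^bsub>G0\<^esub> None = None"
  by (simp_all add: group_with_zero_def split: option.split)

lemma carrier_G0: "carrier G0 = insert None (Some ` carrier G)"
  by (simp add: group_with_zero_def)

lemma sinv_G0:
  assumes "a \<in> carrier G0"
  shows "sinv\<^bsub>G0\<^esub> a = map_option (\<lambda>g. inv g) a"
proof (cases a)
  case None
  have "sinv\<^bsub>G0\<^esub> a = None"
    unfolding sinv_def by (rule the_equality) (auto simp: None carrier_G0 prod_G0)
  then show ?thesis using None by simp
next
  case (Some g)
  then have g: "g \<in> carrier G"
    using assms by (auto simp: carrier_G0)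
  have "sinv\<^bsub>G0\<^esub> a = Some (inv g)"
    unfolding sinv_def
  proof (rule the_equality)
    show "Some (inv g) \<in> carrier G0 \<and> a = a \<star>\<^bsub>G0\<^esub> Some (inv g) \<star>\<^bsub>G0\<^esub> a \<and>
        Some (inv g) = Some (inv g) \<star>\<^bsub>G0\<^esub> a \<star>\<^bsub>G0\<^esub> Some (inv g)"
      using g by (simp add: Some carrier_G0 prod_G0)
  next
    fix y assume y: "y \<in> carrier G0 \<and> a = a \<star>\<^bsub>G0\<^esub> y \<star>\<^bsub>G0\<^esub> a \<and> y = y \<star>\<^bsub>G0\<^esub> a \<star>\<^bsub>G0\<^esub> y"
    then obtain h where h: "y = Some h" "h \<in> carrier G" "g = g \<otimes> h \<otimes> g"
      by (auto simp: Some carrier_G0 prod_G0)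
    \<comment> \<open>Cancelling \<open>g\<close> in \<open>g = g h g\<close>.\<close>
    then have "g \<otimes> h = \<one>"
      using g by (metis m_closed r_cancel_one')
    then show "y = Some (inv g)"
      using g h by (metis inv_equality inv_inv)
  qed
  then show ?thesis using Some by simp
qed

lemma le_G0_iff:
  assumes "a \<in> carrier G0" "b \<in> carrier G0"
  shows "a \<sqsubseteq>\<^bsub>natural_order G0\<^esub> b \<longleftrightarrow> a = None \<or> a = b"
  using assms by (auto simp: natural_order_def sinv_G0 carrier_G0 prod_G0 m_assoc)

text \<open>
  Distinct group elements have no common upper bound, so a set of entries with a supremum contains at
  most one group element, and the supremum is this element if there is one.
\<close>
lemma sup_G0:
  assumes A: "A \<subseteq> {None, a}" "A \<subseteq> carrier G0" "a = None \<or> a \<in> A"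
  shows "\<Squnion>\<^bsub>natural_order G0\<^esub> A = a"
proof -
  have [simp]: "carrier (natural_order G0) = carrier G0"
    by (simp add: natural_order_def)
  have a: "a \<in> carrier G0"
    using assms by (auto simp: carrier_G0)
  have lub: "is_lub (natural_order G0) a A"
  proof (rule least_UpperI)
    fix x assume "x \<in> A"
    then show "x \<sqsubseteq>\<^bsub>natural_order G0\<^esub> a"
      using A a by (subst le_G0_iff) auto
  next
    fix y assume y: "y \<in> Upper (natural_order G0) A"
    then have "y \<in> carrier G0"
      by (simp add: Upper_def)
    show "a \<sqsubseteq>\<^bsub>natural_order G0\<^esub> y"
      using A(3)
    proof
      assume "a = None"
      then show ?thesis using a \<open>y \<in> carrier G0\<close> by (simp add: le_G0_iff)
    next
      assume "a \<in> A"
      then show ?thesis using y a by (simp add: Upper_def)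
    qed
  qed (use A a in simp_all)
  have "w = a" if w: "is_lub (natural_order G0) w A" for w
  proof -
    have "w \<in> carrier G0"
      using least_closed[OF w] by simp
    then show ?thesis
      using least_le[OF w least_mem[OF lub]] least_le[OF lub least_mem[OF w]] a
      by (auto simp: le_G0_iff)
  qed
  then show ?thesis
    unfolding sup_def
    by (intro some_equality[where P = "\<lambda>w. is_lub (natural_order G0) w A"] lub)
qed

lemma rook_matrices_iff:
  "x \<in> rook_matrices n G0 \<longleftrightarrow> x \<in> carrier_mat n n \<and> matrix_chart n x \<in> charts G {..<n}"
proof (cases "x \<in> carrier_mat n n")
  case True
  then have dims: "dim_row x = n" "dim_col x = n"
    by auto
  have carr: "elements_mat x \<subseteq> carrier G0 \<longleftrightarrow> (\<forall>i<n. \<forall>j<n. x $$ (i, j) \<in> carrier G0)"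
    using True dims by (auto dest!: elements_matD)
  have orth1: "sinv\<^bsub>G0\<^esub> a \<star>\<^bsub>G0\<^esub> b = \<^bold>0\<^bsub>G0\<^esub> \<longleftrightarrow> a = None \<or> b = None"
    "a \<star>\<^bsub>G0\<^esub> sinv\<^bsub>G0\<^esub> b = \<^bold>0\<^bsub>G0\<^esub> \<longleftrightarrow> a = None \<or> b = None"
    if "a \<in> carrier G0" "b \<in> carrier G0" for a b
    using that by (auto simp: sinv_G0 carrier_G0 prod_G0 zero_G0)
  show ?thesis
  proof
    assume "x \<in> rook_matrices n G0"
    then have el: "x $$ (i, j) \<in> carrier G0" if "i < n" "j < n" for i j
      using carr that by (auto simp: rook_matrices_def)
    have orth: "(x $$ (i, j) = None \<or> x $$ (i, k) = None) \<and> (x $$ (j, i) = None \<or> x $$ (k, i) = None)"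
      if "i < n" "j < n" "k < n" "j \<noteq> k" for i j k
      using \<open>x \<in> rook_matrices n G0\<close> that orth1 el by (simp add: rook_matrices_def)
    have "matrix_chart n x \<in> charts G {..<n}"
    proof (rule chartsI)
      fix i g j assume "(i, g, j) \<in> matrix_chart n x"
      then show "i \<in> {..<n} \<and> g \<in> carrier G \<and> j \<in> {..<n}"
        using el[of i j] by (auto simp: matrix_chart_iff carrier_G0)
    next
      fix i g j h k assume "(i, g, j) \<in> matrix_chart n x" "(i, h, k) \<in> matrix_chart n x"
      then show "g = h \<and> j = k"
        using orth[of i j k] by (cases "j = k") (auto simp: matrix_chart_iff)
    next
      fix i g j h k assume "(j, g, i) \<in> matrix_chart n x" "(k, h, i) \<in> matrix_chart n x"
      then show "g = h \<and> j = k"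
        using orth[of i j k] by (cases "j = k") (auto simp: matrix_chart_iff)
    qed
    with True show "x \<in> carrier_mat n n \<and> matrix_chart n x \<in> charts G {..<n}" by simp
  next
    assume "x \<in> carrier_mat n n \<and> matrix_chart n x \<in> charts G {..<n}"
    then have X: "matrix_chart n x \<in> charts G {..<n}" by simp
    have el: "x $$ (i, j) \<in> carrier G0" if "i < n" "j < n" for i j
      using chart_carrier(2)[OF X, of i _ j] that
      by (cases "x $$ (i, j)") (auto simp: matrix_chart_iff carrier_G0)
    moreover have "x $$ (i, j) = None \<or> x $$ (i, k) = None" "x $$ (j, i) = None \<or> x $$ (k, i) = None"
      if "i < n" "j < n" "k < n" "j \<noteq> k" for i j k
      using chart_row(2)[OF X, of i "the (x $$ (i, j))" j "the (x $$ (i, k))" k]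
        chart_col(2)[OF X, of j "the (x $$ (j, i))" i k "the (x $$ (k, i))"] that
      by (cases "x $$ (i, j)"; cases "x $$ (i, k)"; cases "x $$ (j, i)"; cases "x $$ (k, i)";
          auto simp: matrix_chart_iff)+
    ultimately show "x \<in> rook_matrices n G0"
      using True carr by (simp add: rook_matrices_def orth1)
  qed
qed (simp add: rook_matrices_def)

lemma chart_matrix_entry:
  assumes X: "X \<in> charts G {..<n}" and ij: "i < n" "j < n"
  shows "chart_matrix n X $$ (i, j) = Some g \<longleftrightarrow> (i, g, j) \<in> X"
proof -
  have "(THE g. (i, g, j) \<in> X) = g" if "(i, g, j) \<in> X" for g
    using that chart_row(1)[OF X that] by (blast intro: the_equality)
  then show ?thesis
    using ij by (auto simp: chart_matrix_def)
qed

lemma matrix_chart_chart_matrix: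
  assumes "X \<in> charts G {..<n}"
  shows "matrix_chart n (chart_matrix n X) = X"
  using chart_carrier[OF assms] 
  by (auto simp: matrix_chart_def chart_matrix_entry[OF assms])

lemma chart_matrix_closed:
  assumes "X \<in> charts G {..<n}"
  shows "chart_matrix n X \<in> rook_matrices n G0"
  unfolding rook_matrices_iff matrix_chart_chart_matrix[OF assms]
  using assms by (simp add: chart_matrix_def)

lemma matrix_chart_inj:
  assumes "x \<in> carrier_mat n n" "y \<in> carrier_mat n n" "matrix_chart n x = matrix_chart n y"
  shows "x = y"
proof (rule eq_matI)
  fix i j assume ij: "i < dim_row y" "j < dim_col y"
  then have "x $$ (i, j) = Some g \<longleftrightarrow> y $$ (i, j) = Some g" for g
    using assms matrix_chart_iff[of i g j n x] matrix_chart_iff[of i g j n y] by auto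
  then show "x $$ (i, j) = y $$ (i, j)"
    by (metis option.exhaust)
qed (use assms in auto)

text \<open>
  The nonzero summands of the entry at \<open>(i, j)\<close> are the labels of the arrows from \<open>i\<close> to \<open>j\<close> in the composed
  chart. As that is a chart, at most one value occurs, and the orthogonal sum is that value.
\<close>
lemma rook_prod_entry:
  assumes x: "x \<in> rook_matrices n G0" and y: "y \<in> rook_matrices n G0" and ij: "i < n" "j < n"
  shows "(x \<star>\<^bsub>rook_semigroup n G0\<^esub> y) $$ (i, j) = Some u
    \<longleftrightarrow> (i, u, j) \<in> matrix_chart n x \<diamondop> matrix_chart n y"
proof -
  let ?X = "matrix_chart n x" and ?Y = "matrix_chart n y"
  define A where "A = {x $$ (i, k) \<star>\<^bsub>G0\<^esub> y $$ (k, j) |k. k < n}"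
  have XY: "?X \<diamondop> ?Y \<in> charts G {..<n}"
    using x y by (simp add: rook_matrices_iff chart_mult_closed)
  have mem_A: "Some v \<in> A \<longleftrightarrow> (i, v, j) \<in> ?X \<diamondop> ?Y" for v
  proof
    assume "Some v \<in> A"
    then obtain k where "k < n" "Some v = x $$ (i, k) \<star>\<^bsub>G0\<^esub> y $$ (k, j)"
      by (auto simp: A_def)
    moreover from this obtain g h where "x $$ (i, k) = Some g" "y $$ (k, j) = Some h"
      by (cases "x $$ (i, k)"; cases "y $$ (k, j)") (auto simp: prod_G0)
    ultimately show "(i, v, j) \<in> ?X \<diamondop> ?Y"
      using ij chart_multI[of i g k ?X h j ?Y G] by (simp add: prod_G0 matrix_chart_iff)
  next
    assume "(i, v, j) \<in> ?X \<diamondop> ?Y"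
    then obtain g k h where "v = g \<otimes> h" "(i, g, k) \<in> ?X" "(k, h, j) \<in> ?Y"
      by (rule chart_multE)
    then have "k < n" "Some v = x $$ (i, k) \<star>\<^bsub>G0\<^esub> y $$ (k, j)"
      by (simp_all add: matrix_chart_iff prod_G0)
    then show "Some v \<in> A" by (auto simp: A_def)
  qed
  have carr: "A \<subseteq> carrier G0"
  proof
    fix a assume "a \<in> A"
    then show "a \<in> carrier G0"
      using mem_A[of "the a"] chart_carrier(2)[OF XY, of i "the a" j] by (cases a) (auto simp: carrier_G0)
  qed
  have eq: "(x \<star>\<^bsub>rook_semigroup n G0\<^esub> y) $$ (i, j) = \<Squnion>\<^bsub>natural_order G0\<^esub> A"
    using ij by (simp add: rook_semigroup_def A_def)
  show ?thesis
  proof (cases "\<exists>v. Some v \<in> A")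
    case True
    then obtain v where v: "Some v \<in> A" by blast
    have uniq: "w = v" if "Some w \<in> A" for w
      using that v chart_row(1)[OF XY, of i w j v j] by (simp only: mem_A)
    have "a \<in> {None, Some v}" if "a \<in> A" for a
      using that uniq by (cases a) auto
    then have "A \<subseteq> {None, Some v}"
      by blast
    then have "\<Squnion>\<^bsub>natural_order G0\<^esub> A = Some v"
      using carr v by (intro sup_G0) simp_all
    then show ?thesis
      unfolding eq mem_A[symmetric] using v uniq[of u] by auto
  next
    case False
    have "a \<in> {None, None}" if "a \<in> A" for a
      using that False by (cases a) auto
    then have "A \<subseteq> {None, None}"
      by blast
    then have "\<Squnion>\<^bsub>natural_order G0\<^esub> A = None"
      using carr by (intro sup_G0) simp_all
    then show ?thesis
      unfolding eq mem_A[symmetric] using False by auto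
  qed
qed

lemma rook_prod:
  assumes x: "x \<in> rook_matrices n G0" and y: "y \<in> rook_matrices n G0"
  shows "matrix_chart n (x \<star>\<^bsub>rook_semigroup n G0\<^esub> y) = matrix_chart n x \<diamondop> matrix_chart n y"
    and "x \<star>\<^bsub>rook_semigroup n G0\<^esub> y \<in> rook_matrices n G0"
proof -
  have XY: "matrix_chart n x \<diamondop> matrix_chart n y \<in> charts G {..<n}"
    using x y by (simp add: rook_matrices_iff chart_mult_closed)
  show *: "matrix_chart n (x \<star>\<^bsub>rook_semigroup n G0\<^esub> y) = matrix_chart n x \<diamondop> matrix_chart n y"
    using chart_carrier(1,3)[OF XY]
    by (auto simp: matrix_chart_def[of n "x \<star>\<^bsub>rook_semigroup n G0\<^esub> y"] rook_prod_entry[OF x y])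
  show "x \<star>\<^bsub>rook_semigroup n G0\<^esub> y \<in> rook_matrices n G0"
    unfolding rook_matrices_iff * using XY by (simp add: rook_semigroup_def)
qed

lemma carrier_rook: "carrier (rook_semigroup n G0) = rook_matrices n G0"
  by (simp add: rook_semigroup_def)

lemma rook_chart_semigroup: "chart_semigroup G (rook_semigroup n G0) {..<n} (matrix_chart n)"
proof (intro chart_semigroup.intro chart_semigroup_axioms.intro)
  show "group G" ..
  show "bij_betw (matrix_chart n) (carrier (rook_semigroup n G0)) (charts G {..<n})"
  proof (rule bij_betw_byWitness[where f' = "chart_matrix n"])
    show "\<forall>x\<in>carrier (rook_semigroup n G0). chart_matrix n (matrix_chart n x) = x"
    proof
      fix x assume "x \<in> carrier (rook_semigroup n G0)"
      then show "chart_matrix n (matrix_chart n x) = x"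
        using chart_matrix_closed[of "matrix_chart n x" n] 
        by (intro matrix_chart_inj[of _ n])
          (simp_all add: carrier_rook rook_matrices_iff matrix_chart_chart_matrix)
    qed
  qed (simp_all add: carrier_rook image_subset_iff matrix_chart_chart_matrix chart_matrix_closed
      rook_matrices_iff[THEN iffD1])
  show zero: "matrix_chart n \<^bold>0\<^bsub>rook_semigroup n G0\<^esub> = {}"
    by (auto simp: matrix_chart_def rook_semigroup_def zero_G0)
  show "\<^bold>0\<^bsub>rook_semigroup n G0\<^esub> \<in> carrier (rook_semigroup n G0)"
    using zero by (simp add: carrier_rook rook_matrices_iff empty_chart) (simp add: rook_semigroup_def)
qed (simp_all add: rook_prod carrier_rook)

end

section \<open>Wreath products as groups of full charts\<close>

text \<open>
  The invertible monomial matrices.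
\<close>
definition full_charts :: "('h, 'd) monoid_scheme \<Rightarrow> 'k set \<Rightarrow> ('k \<times> 'h \<times> 'k) set set" where
  "full_charts H K = {X \<in> charts H K. row_set X = K \<and> col_set X = K}"

text \<open>
  A faithful monomial representation of \<open>G\<close> over \<open>H\<close>. The set \<open>K\<close> is arbitrary because the
  representation extracted from an embedding lives on a subset of the indices that need not be an
  initial segment.
\<close>
definition monomial_rep ::
    "('g, 'c) monoid_scheme \<Rightarrow> ('h, 'd) monoid_scheme \<Rightarrow> 'k set \<Rightarrow> ('g \<Rightarrow> ('k \<times> 'h \<times> 'k) set) \<Rightarrow> bool"
  where
  "monomial_rep G H K W \<longleftrightarrow> W \<in> carrier G \<rightarrow> full_charts H K \<and> inj_on W (carrier G) \<and>
     (\<forall>g\<in>carrier G. \<forall>h\<in>carrier G. W (g \<otimes>\<^bsub>G\<^esub> h) = W g \<diamondop>\<^bsub>H\<^esub> W h)"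

text \<open>
  The inverse permutation appears because \<open>\<sigma>\<close> acts on tuples by moving the coordinate \<open>\<sigma>\<inverse> a\<close> to position
  \<open>a\<close>: the second factor of a product contributes its label at \<open>\<sigma>\<inverse> a\<close>, which is the index that the first
  factor leads to from \<open>a\<close>.
\<close>
definition wreath_chart :: "nat \<Rightarrow> (nat \<Rightarrow> 'h) \<times> (nat \<Rightarrow> nat) \<Rightarrow> (nat \<times> 'h \<times> nat) set" where
  "wreath_chart k u = {(a, fst u a, inv' (snd u) a) | a. a \<in> {1..k}}"

lemma wreath_chart_iff:
  "(a, x, b) \<in> wreath_chart k (h, \<sigma>) \<longleftrightarrow> a \<in> {1..k} \<and> x = h a \<and> b = inv' \<sigma> a"
  by (auto simp: wreath_chart_def)

lemma wreath_carrier_iff: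
  "(h, \<sigma>) \<in> carrier (wreath_product H k) \<longleftrightarrow> h \<in> {1..k} \<rightarrow>\<^sub>E carrier H \<and> \<sigma> permutes {1..k}"
  by (simp add: wreath_product_def semidirect_product_def sym_group_def)

lemma wreath_chart_full:
  assumes "u \<in> carrier (wreath_product H k)"
  shows "wreath_chart k u \<in> full_charts H {1..k}"
proof -
  obtain h \<sigma> where u: "u = (h, \<sigma>)" by (cases u)
  then have h: "h \<in> {1..k} \<rightarrow>\<^sub>E carrier H" and "\<sigma> permutes {1..k}"
    using assms by (simp_all add: wreath_carrier_iff)
  then have p: "inv' \<sigma> permutes {1..k}"
    by (simp add: permutes_inv)
  have "wreath_chart k (h, \<sigma>) \<in> charts H {1..k}"
  proof (rule chartsI)
    fix a x b assume "(a, x, b) \<in> wreath_chart k (h, \<sigma>)"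
    then show "a \<in> {1..k} \<and> x \<in> carrier H \<and> b \<in> {1..k}"
      using h permutes_in_image[OF p] unfolding wreath_chart_iff by blast
  next
    fix a x b y c assume "(a, x, b) \<in> wreath_chart k (h, \<sigma>)" "(a, y, c) \<in> wreath_chart k (h, \<sigma>)"
    then show "x = y \<and> b = c"
      by (simp add: wreath_chart_iff)
  next
    fix a x b y c assume "(b, x, a) \<in> wreath_chart k (h, \<sigma>)" "(c, y, a) \<in> wreath_chart k (h, \<sigma>)"
    then show "x = y \<and> b = c"
      using injD[OF permutes_inj[OF p], of b c] by (simp add: wreath_chart_iff)
  qed
  moreover have "row_set (wreath_chart k (h, \<sigma>)) = {1..k}"
    by (auto simp: in_rows_iff wreath_chart_iff)
  moreover have "col_set (wreath_chart k (h, \<sigma>)) = inv' \<sigma> ` {1..k}"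
    by (auto simp: in_cols_iff wreath_chart_iff)
  ultimately show ?thesis
    using permutes_image[OF p] by (simp add: u full_charts_def)
qed

lemma wreath_chart_inj: "inj_on (wreath_chart k) (carrier (wreath_product H k))"
proof (rule inj_onI)
  fix u v
  assume uv: "u \<in> carrier (wreath_product H k)" "v \<in> carrier (wreath_product H k)"
    and eq: "wreath_chart k u = wreath_chart k v"
  obtain h \<sigma> h' \<tau> where u: "u = (h, \<sigma>)" and v: "v = (h', \<tau>)" by (cases u, cases v)
  have h: "h \<in> {1..k} \<rightarrow>\<^sub>E carrier H" "h' \<in> {1..k} \<rightarrow>\<^sub>E carrier H"
    and p: "\<sigma> permutes {1..k}" "\<tau> permutes {1..k}"
    using uv by (simp_all add: u v wreath_carrier_iff)
  have *: "h a = h' a \<and> inv' \<sigma> a = inv' \<tau> a" if "a \<in> {1..k}" for a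
    using that eq wreath_chart_iff[of a "h a" "inv' \<sigma> a" k h \<sigma>]
      wreath_chart_iff[of a "h a" "inv' \<sigma> a" k h' \<tau>]
    by (simp add: u v)
  have "h = h'"
    using h * by (intro PiE_ext) auto
  moreover have "inv' \<sigma> a = inv' \<tau> a" for a
    using * permutes_not_in[OF permutes_inv[OF p(1)], of a] permutes_not_in[OF permutes_inv[OF p(2)], of a]
    by (cases "a \<in> {1..k}") simp_all
  then have "\<sigma> = \<tau>"
    using permutes_inv_inv[OF p(1)] permutes_inv_inv[OF p(2)] by (metis ext)
  ultimately show "u = v"
    by (simp add: u v)
qed

lemma wreath_chart_mult:
  assumes "group H" and "u \<in> carrier (wreath_product H k)" "v \<in> carrier (wreath_product H k)"
  shows "u \<otimes>\<^bsub>wreath_product H k\<^esub> v \<in> carrier (wreath_product H k)"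
    and "wreath_chart k (u \<otimes>\<^bsub>wreath_product H k\<^esub> v) = wreath_chart k u \<diamondop>\<^bsub>H\<^esub> wreath_chart k v"
proof -
  obtain h \<sigma> h' \<tau> where u: "u = (h, \<sigma>)" and v: "v = (h', \<tau>)" by (cases u, cases v)
  have h: "h \<in> {1..k} \<rightarrow>\<^sub>E carrier H" "h' \<in> {1..k} \<rightarrow>\<^sub>E carrier H"
    and p: "\<sigma> permutes {1..k}" "\<tau> permutes {1..k}"
    using assms by (simp_all add: u v wreath_carrier_iff)
  have i: "inv' (\<sigma> \<circ> \<tau>) = inv' \<tau> \<circ> inv' \<sigma>"
    using p by (simp add: o_inv_distrib permutes_bij)
  have in_k: "inv' \<sigma> a \<in> {1..k} \<longleftrightarrow> a \<in> {1..k}" for a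
    using permutes_in_image[OF permutes_inv[OF p(1)]] .
  have uv: "u \<otimes>\<^bsub>wreath_product H k\<^esub> v
      = (\<lambda>a\<in>{1..k}. h a \<otimes>\<^bsub>H\<^esub> (\<lambda>a\<in>{1..k}. h' (inv' \<sigma> a)) a, \<sigma> \<circ> \<tau>)"
    by (simp add: u v wreath_product_def semidirect_product_def sym_group_def)
  have "h a \<otimes>\<^bsub>H\<^esub> h' (inv' \<sigma> a) \<in> carrier H" if "a \<in> {1..k}" for a
    using that in_k[of a] h by (intro monoid.m_closed group.is_monoid assms(1)) auto
  then show "u \<otimes>\<^bsub>wreath_product H k\<^esub> v \<in> carrier (wreath_product H k)"
    using permutes_compose[OF p(2,1)] by (auto simp: uv wreath_carrier_iff)
  show "wreath_chart k (u \<otimes>\<^bsub>wreath_product H k\<^esub> v) = wreath_chart k u \<diamondop>\<^bsub>H\<^esub> wreath_chart k v"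
  proof (intro equalityI subrelI; clarify)
    fix a x b assume "(a, x, b) \<in> wreath_chart k (u \<otimes>\<^bsub>wreath_product H k\<^esub> v)"
    then have a: "a \<in> {1..k}" and "x = h a \<otimes>\<^bsub>H\<^esub> h' (inv' \<sigma> a)" "b = inv' \<tau> (inv' \<sigma> a)"
      by (auto simp: uv wreath_chart_iff i)
    moreover have "(a, h a, inv' \<sigma> a) \<in> wreath_chart k u"
      "(inv' \<sigma> a, h' (inv' \<sigma> a), inv' \<tau> (inv' \<sigma> a)) \<in> wreath_chart k v"
      using a in_k[of a] by (simp_all add: u v wreath_chart_iff)
    ultimately show "(a, x, b) \<in> wreath_chart k u \<diamondop>\<^bsub>H\<^esub> wreath_chart k v"
      using chart_multI by metis
  next
    fix a x b assume "(a, x, b) \<in> wreath_chart k u \<diamondop>\<^bsub>H\<^esub> wreath_chart k v"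
    then show "(a, x, b) \<in> wreath_chart k (u \<otimes>\<^bsub>wreath_product H k\<^esub> v)"
      unfolding uv by (elim chart_multE) (auto simp: u v wreath_chart_iff i)
  qed
qed

text \<open>
  A full chart consists of exactly one arrow out of each index; the labels give the tuple, and the
  end points a permutation, whose inverse is the second component.
\<close>
lemma wreath_chart_surj:
  assumes "X \<in> full_charts H {1..k}"
  obtains u where "u \<in> carrier (wreath_product H k)" "wreath_chart k u = X"
proof -
  have X: "X \<in> charts H {1..k}" and rows: "row_set X = {1..k}" and cols: "col_set X = {1..k}"
    using assms by (simp_all add: full_charts_def)
  have "\<exists>p. (a, p) \<in> X" if "a \<in> {1..k}" for a
    using that in_rows_iff[of a X] by (auto simp: rows)
  then obtain p where p: "\<And>a. a \<in> {1..k} \<Longrightarrow> (a, p a) \<in> X"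
    by metis
  define h where "h = (\<lambda>a\<in>{1..k}. fst (p a))"
  define \<rho> where "\<rho> a = (if a \<in> {1..k} then snd (p a) else a)" for a
  have mem: "(a, h a, \<rho> a) \<in> X" if "a \<in> {1..k}" for a
    using p[OF that] that by (simp add: h_def \<rho>_def)
  have X_iff: "(a, x, b) \<in> X \<longleftrightarrow> a \<in> {1..k} \<and> x = h a \<and> b = \<rho> a" for a x b
    using mem[of a] chart_row[OF X, of a x b "h a" "\<rho> a"] chart_carrier(1)[OF X, of a x b] by auto
  have "b \<in> \<rho> ` {1..k} \<longleftrightarrow> b \<in> {1..k}" for b
    using in_cols_iff[of b X] unfolding cols X_iff by blast
  then have "\<rho> ` {1..k} = {1..k}"
    by blast
  moreover have "inj_on \<rho> {1..k}"
  proof (rule inj_onI)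
    fix a b assume "a \<in> {1..k}" "b \<in> {1..k}" "\<rho> a = \<rho> b"
    then show "a = b"
      using chart_col(2)[OF X mem[of a], of b "h b"] mem[of b] by simp
  qed
  ultimately have \<rho>: "\<rho> permutes {1..k}"
    by (intro bij_imp_permutes) (auto simp: bij_betw_def \<rho>_def)
  have "h \<in> {1..k} \<rightarrow>\<^sub>E carrier H"
    using chart_carrier(2)[OF X mem] by (auto simp: h_def)
  then have "(h, inv' \<rho>) \<in> carrier (wreath_product H k)"
    using \<rho> by (simp add: wreath_carrier_iff permutes_inv)
  moreover have "wreath_chart k (h, inv' \<rho>) = X"
    using permutes_inv_inv[OF \<rho>] by (auto simp: wreath_chart_iff X_iff)
  ultimately show ?thesis
    by (rule that)
qed

text \<open>
  The maps \<open>wreath_chart k\<close> identify the wreath product with the full charts on \<open>k\<close> indices, and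
  composing with this identification translates homomorphisms into representations.
\<close>
lemma mon_wreath_product_iff:
  assumes "group G" and "group H"
  shows "mon G (wreath_product H k) \<noteq> {} \<longleftrightarrow> (\<exists>W. monomial_rep G H {1..k} W)"
proof
  assume "mon G (wreath_product H k) \<noteq> {}"
  then obtain \<phi> where hom: "\<phi> \<in> hom G (wreath_product H k)" and inj: "inj_on \<phi> (carrier G)"
    by (auto simp: mon_def)
  have \<phi>: "\<phi> g \<in> carrier (wreath_product H k)" if "g \<in> carrier G" for g
    using hom_in_carrier[OF hom that] .
  have "monomial_rep G H {1..k} (wreath_chart k \<circ> \<phi>)"
    unfolding monomial_rep_def
  proof (intro conjI ballI)
    show "wreath_chart k \<circ> \<phi> \<in> carrier G \<rightarrow> full_charts H {1..k}"
      by (intro Pi_I) (simp only: comp_apply wreath_chart_full \<phi>)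
    show "inj_on (wreath_chart k \<circ> \<phi>) (carrier G)"
      using inj \<phi> by (intro comp_inj_on inj_on_subset[OF wreath_chart_inj]) auto
    show "(wreath_chart k \<circ> \<phi>) (g \<otimes>\<^bsub>G\<^esub> h) = (wreath_chart k \<circ> \<phi>) g \<diamondop>\<^bsub>H\<^esub> (wreath_chart k \<circ> \<phi>) h"
      if "g \<in> carrier G" "h \<in> carrier G" for g h
      using wreath_chart_mult(2)[OF assms(2) \<phi>[OF that(1)] \<phi>[OF that(2)]] hom_mult[OF hom that] by simp
  qed
  then show "\<exists>W. monomial_rep G H {1..k} W"
    by (rule exI[of _ "wreath_chart k \<circ> \<phi>"])
next
  assume "\<exists>W. monomial_rep G H {1..k} W"
  then obtain W where W: "W \<in> carrier G \<rightarrow> full_charts H {1..k}" "inj_on W (carrier G)"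
      "\<And>g h. \<lbrakk>g \<in> carrier G; h \<in> carrier G\<rbrakk> \<Longrightarrow> W (g \<otimes>\<^bsub>G\<^esub> h) = W g \<diamondop>\<^bsub>H\<^esub> W h"
    unfolding monomial_rep_def by blast
  have "\<exists>u. u \<in> carrier (wreath_product H k) \<and> wreath_chart k u = W g" if "g \<in> carrier G" for g
    using wreath_chart_surj[OF funcset_mem[OF W(1) that]] by metis
  then obtain \<phi> where \<phi>: "\<And>g. g \<in> carrier G \<Longrightarrow> \<phi> g \<in> carrier (wreath_product H k)"
    and \<phi>_W: "\<And>g. g \<in> carrier G \<Longrightarrow> wreath_chart k (\<phi> g) = W g"
    by metis
  have "\<phi> (g \<otimes>\<^bsub>G\<^esub> h) = \<phi> g \<otimes>\<^bsub>wreath_product H k\<^esub> \<phi> h" if g: "g \<in> carrier G" and h: "h \<in> carrier G" for g h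
  proof (rule inj_onD[OF wreath_chart_inj])
    have gh: "g \<otimes>\<^bsub>G\<^esub> h \<in> carrier G"
      using g h \<open>group G\<close> by (simp add: group.is_monoid monoid.m_closed)
    show "wreath_chart k (\<phi> (g \<otimes>\<^bsub>G\<^esub> h)) = wreath_chart k (\<phi> g \<otimes>\<^bsub>wreath_product H k\<^esub> \<phi> h)"
      using wreath_chart_mult(2)[OF \<open>group H\<close> \<phi>[OF g] \<phi>[OF h]]
      by (simp add: \<phi>_W gh g h W(3))
    show "\<phi> (g \<otimes>\<^bsub>G\<^esub> h) \<in> carrier (wreath_product H k)"
      by (rule \<phi>[OF gh])
    show "\<phi> g \<otimes>\<^bsub>wreath_product H k\<^esub> \<phi> h \<in> carrier (wreath_product H k)"
      by (rule wreath_chart_mult(1)[OF \<open>group H\<close> \<phi>[OF g] \<phi>[OF h]])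
  qed
  then have "\<phi> \<in> hom G (wreath_product H k)"
    using \<phi> by (simp add: hom_def)
  moreover have "inj_on \<phi> (carrier G)"
    by (rule inj_onI) (metis W(2) \<phi>_W inj_onD)
  ultimately show "mon G (wreath_product H k) \<noteq> {}"
    by (auto simp: mon_def)
qed

lemma monomial_rep_mult:
  "\<lbrakk>monomial_rep G H K W; g \<in> carrier G; h \<in> carrier G\<rbrakk> \<Longrightarrow> W (g \<otimes>\<^bsub>G\<^esub> h) = W g \<diamondop>\<^bsub>H\<^esub> W h"
  by (simp add: monomial_rep_def)

lemma monomial_rep_chart:
  assumes "monomial_rep G H K W" and "g \<in> carrier G"
  shows "W g \<in> charts H K" "row_set (W g) = K" "col_set (W g) = K"
  using assms by (auto simp: monomial_rep_def full_charts_def)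

lemma monomial_rep_inj:
  "\<lbrakk>monomial_rep G H K W; g \<in> carrier G; h \<in> carrier G\<rbrakk> \<Longrightarrow> W g = W h \<longleftrightarrow> g = h"
  by (auto simp: monomial_rep_def dest: inj_onD)

text \<open>
  Transport the representation along the injection and let every group element act on the remaining
  indices as the identity. This is how \<open>H \<wr> \<SS>\<^sub>l\<close> embeds into \<open>H \<wr> \<SS>\<^sub>k\<close> for \<open>l \<le> k\<close>.
\<close>
lemma monomial_rep_extend:
  assumes rep: "monomial_rep G H K W" and "group H"
    and inj: "inj_on e K" and sub: "e ` K \<subseteq> L"
  shows "\<exists>V. monomial_rep G H L V"
proof -
  interpret H: group H by fact
  define V where "V g = {(e a, u, e b) | a u b. (a, u, b) \<in> W g} \<union> unit_chart H (L - e ` K)" for g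
  have dom: "a \<in> K" "u \<in> carrier H" "b \<in> K" if "g \<in> carrier G" "(a, u, b) \<in> W g" for g a u b
    using chart_carrier[OF monomial_rep_chart(1)[OF rep that(1)] that(2)] by simp_all
  \<comment> \<open>The arrows at an index in the image of \<open>e\<close> are those of \<open>W g\<close>;
    at any other index there is a loop only.\<close>
  have V_old: "(e a, u, y) \<in> V g \<longleftrightarrow> (\<exists>b. y = e b \<and> (a, u, b) \<in> W g)"
    "(y, u, e a) \<in> V g \<longleftrightarrow> (\<exists>b. y = e b \<and> (b, u, a) \<in> W g)"
    if "g \<in> carrier G" "a \<in> K" for g a u y
    using that dom[OF that(1)] inj by (auto simp: V_def unit_chart_iff dest!: inj_onD)
  have V_new: "(x, u, y) \<in> V g \<longleftrightarrow> x \<in> L \<and> u = \<one>\<^bsub>H\<^esub> \<and> y = x"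
    "(y, u, x) \<in> V g \<longleftrightarrow> x \<in> L \<and> u = \<one>\<^bsub>H\<^esub> \<and> y = x"
    if "g \<in> carrier G" "x \<notin> e ` K" for g x u y
    using that dom[OF that(1)] by (auto simp: V_def unit_chart_iff)
  have in_L: "x \<in> L" "y \<in> L" "u \<in> carrier H" if "g \<in> carrier G" "(x, u, y) \<in> V g" for g x u y
    using that(2) dom[OF that(1)] sub by (auto simp: V_def unit_chart_iff)
  have chart: "V g \<in> charts H L" if g: "g \<in> carrier G" for g
  proof (rule chartsI)
    note Wg = monomial_rep_chart(1)[OF rep g]
    show "x \<in> L \<and> u \<in> carrier H \<and> y \<in> L" if "(x, u, y) \<in> V g" for x u y
      using in_L[OF g that] by simp
    show "u = v \<and> y = z" if "(x, u, y) \<in> V g" "(x, v, z) \<in> V g" for x u y v z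
    proof (cases "x \<in> e ` K")
      case True
      then obtain a where a: "x = e a" "a \<in> K" by blast
      with that V_old(1)[OF g a(2)] obtain b c
        where "y = e b" "z = e c" "(a, u, b) \<in> W g" "(a, v, c) \<in> W g"
        by auto
      then show ?thesis using chart_row[OF Wg, of a u b v c] by simp
    next
      case False
      then show ?thesis using that V_new(1)[OF g False] by simp
    qed
    show "u = v \<and> y = z" if "(y, u, x) \<in> V g" "(z, v, x) \<in> V g" for x u y v z
    proof (cases "x \<in> e ` K")
      case True
      then obtain a where a: "x = e a" "a \<in> K" by blast
      with that V_old(2)[OF g a(2)] obtain b c
        where "y = e b" "z = e c" "(b, u, a) \<in> W g" "(c, v, a) \<in> W g"
        by auto
      then show ?thesis using chart_col[OF Wg, of b u a c v] by simp
    next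
      case False
      then show ?thesis using that V_new(2)[OF g False] by simp
    qed
  qed
  have full: "V g \<in> full_charts H L" if g: "g \<in> carrier G" for g
  proof -
    have "x \<in> row_set (V g) \<and> x \<in> col_set (V g)" if x: "x \<in> L" for x
    proof (cases "x \<in> e ` K")
      case True
      then obtain a where a: "x = e a" "a \<in> K" by blast
      then have "a \<in> row_set (W g)" "a \<in> col_set (W g)"
        using monomial_rep_chart(2,3)[OF rep g] by simp_all
      then show ?thesis
        using V_old[OF g a(2)] by (auto simp: a(1) in_rows_iff in_cols_iff)
    next
      case False
      then show ?thesis
        using V_new[OF g False] x by (auto simp: in_rows_iff in_cols_iff)
    qed
    moreover have "row_set (V g) \<subseteq> L" "col_set (V g) \<subseteq> L"
      using in_L[OF g] by (auto simp: in_rows_iff in_cols_iff)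
    ultimately show ?thesis
      using chart[OF g] by (auto simp: full_charts_def)
  qed
  have mult: "V (g \<otimes>\<^bsub>G\<^esub> h) = V g \<diamondop>\<^bsub>H\<^esub> V h" if g: "g \<in> carrier G" and h: "h \<in> carrier G" for g h
  proof -
    have V_gh: "(x, w, y) \<in> V (g \<otimes>\<^bsub>G\<^esub> h) \<longleftrightarrow>
        (\<exists>a b. x = e a \<and> y = e b \<and> (a, w, b) \<in> W g \<diamondop>\<^bsub>H\<^esub> W h) \<or>
        x \<in> L \<and> x \<notin> e ` K \<and> w = \<one>\<^bsub>H\<^esub> \<and> y = x" for x w y
      by (auto simp: V_def monomial_rep_mult[OF rep g h] unit_chart_iff)
    show ?thesis
    proof (intro equalityI subrelI; clarify)
      fix x w y assume "(x, w, y) \<in> V g \<diamondop>\<^bsub>H\<^esub> V h"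
      then obtain u z v where w: "w = u \<otimes>\<^bsub>H\<^esub> v" and xz: "(x, u, z) \<in> V g" and zy: "(z, v, y) \<in> V h"
        by (rule chart_multE)
      show "(x, w, y) \<in> V (g \<otimes>\<^bsub>G\<^esub> h)"
      proof (cases "z \<in> e ` K")
        case True
        then obtain c where c: "z = e c" "c \<in> K" by blast
        with xz zy V_old(2)[OF g c(2)] V_old(1)[OF h c(2)] obtain a b
          where "x = e a" "y = e b" "(a, u, c) \<in> W g" "(c, v, b) \<in> W h"
          by auto
        then show ?thesis unfolding V_gh using w chart_multI[of a u c "W g" v b "W h" H] by blast
      next
        case False
        then have "z \<in> L" "u = \<one>\<^bsub>H\<^esub>" "v = \<one>\<^bsub>H\<^esub>" "x = z" "y = z"
          using xz zy V_new(2)[OF g False] V_new(1)[OF h False] by simp_all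
        then show ?thesis unfolding V_gh using w False by simp
      qed
    next
      fix x w y assume "(x, w, y) \<in> V (g \<otimes>\<^bsub>G\<^esub> h)"
      then consider a b where "x = e a" "y = e b" "(a, w, b) \<in> W g \<diamondop>\<^bsub>H\<^esub> W h"
        | "x \<in> L" "x \<notin> e ` K" "w = \<one>\<^bsub>H\<^esub>" "y = x"
        unfolding V_gh by blast
      then show "(x, w, y) \<in> V g \<diamondop>\<^bsub>H\<^esub> V h"
      proof cases
        case (1 a b)
        from 1(3) obtain u c v where "w = u \<otimes>\<^bsub>H\<^esub> v" "(a, u, c) \<in> W g" "(c, v, b) \<in> W h"
          by (rule chart_multE)
        moreover from this have "(x, u, e c) \<in> V g" "(e c, v, y) \<in> V h"
          using 1 by (auto simp: V_def)
        ultimately show ?thesis by (simp add: chart_multI)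
      next
        case 2
        then have "(x, \<one>\<^bsub>H\<^esub>, x) \<in> V g" "(x, \<one>\<^bsub>H\<^esub>, y) \<in> V h"
          using V_new(1)[OF g 2(2)] V_new(1)[OF h 2(2)] by simp_all
        from chart_multI[OF this, of H] show ?thesis using 2 by simp
      qed
    qed
  qed
  have "W g = W h" if g: "g \<in> carrier G" and h: "h \<in> carrier G" and eq: "V g = V h" for g h
  proof -
    have "(a, u, b) \<in> W g \<longleftrightarrow> (a, u, b) \<in> W h" for a u b
    proof (cases "a \<in> K \<and> b \<in> K")
      case True
      then have "(a, u, b) \<in> W k \<longleftrightarrow> (e a, u, e b) \<in> V k" if "k \<in> carrier G" for k
        using V_old(1)[OF that, of a u "e b"] dom(3)[OF that, of a u] True inj by (metis inj_onD)
      then show ?thesis using eq g h by simp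
    next
      case False
      then show ?thesis using dom(1,3) g h by blast
    qed
    then show ?thesis by auto
  qed
  then have "inj_on V (carrier G)"
    using monomial_rep_inj[OF rep] by (auto intro!: inj_onI)
  then have "monomial_rep G H L V"
    using full mult by (auto simp: monomial_rep_def)
  then show ?thesis by (rule exI[of _ V])
qed

section \<open>From a monomial representation to an embedding\<close>

text \<open>
  Substitution of the block \<open>W g\<close> for each entry \<open>g\<close>; \<open>e i a\<close> is the place of the index \<open>a\<close> of the block
  in row or column \<open>i\<close>.
\<close>
definition inflate ::
    "('i \<Rightarrow> 'k \<Rightarrow> 'j) \<Rightarrow> ('g \<Rightarrow> ('k \<times> 'h \<times> 'k) set) \<Rightarrow> ('i \<times> 'g \<times> 'i) set \<Rightarrow> ('j \<times> 'h \<times> 'j) set"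
  where
  "inflate e W X = {(e i a, u, e j b) | i g j a u b. (i, g, j) \<in> X \<and> (a, u, b) \<in> W g}"

lemma inflateI:
  "\<lbrakk>(i, g, j) \<in> X; (a, u, b) \<in> W g\<rbrakk> \<Longrightarrow> (e i a, u, e j b) \<in> inflate e W X"
  unfolding inflate_def by blast

text \<open>
  As \<open>e\<close> is injective, the position of an arrow determines the block that it comes from.
\<close>
lemma inflate_iff:
  assumes rep: "monomial_rep G H K W" and X: "X \<in> charts G J"
    and inj: "inj_on (case_prod e) (J \<times> K)" and "i \<in> J" "a \<in> K" "j \<in> J" "b \<in> K"
  shows "(e i a, u, e j b) \<in> inflate e W X \<longleftrightarrow> (\<exists>g. (i, g, j) \<in> X \<and> (a, u, b) \<in> W g)"
proof
  assume "(e i a, u, e j b) \<in> inflate e W X"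
  then obtain i' g j' a' b' where *: "e i a = e i' a'" "e j b = e j' b'"
    and X': "(i', g, j') \<in> X" and W': "(a', u, b') \<in> W g"
    by (auto simp: inflate_def)
  have "i' \<in> J" "j' \<in> J" "g \<in> carrier G"
    using chart_carrier[OF X X'] by simp_all
  moreover from this have "a' \<in> K" "b' \<in> K"
    using chart_carrier[OF monomial_rep_chart(1)[OF rep] W'] by simp_all
  ultimately have "(i, a) = (i', a')" "(j, b) = (j', b')"
    using * assms(4-) inj_onD[OF inj, of "(i, a)" "(i', a')"] inj_onD[OF inj, of "(j, b)" "(j', b')"]
    by simp_all
  then show "\<exists>g. (i, g, j) \<in> X \<and> (a, u, b) \<in> W g"
    using X' W' by auto
qed (auto intro: inflateI)

lemma inflateE:
  assumes "(x, u, y) \<in> inflate e W X" and rep: "monomial_rep G H K W" and X: "X \<in> charts G J"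
  obtains i g j a b where "x = e i a" "y = e j b" "(i, g, j) \<in> X" "(a, u, b) \<in> W g"
    "i \<in> J" "j \<in> J" "a \<in> K" "b \<in> K" "g \<in> carrier G" "u \<in> carrier H"
proof -
  obtain i g j a b where *: "x = e i a" "y = e j b" "(i, g, j) \<in> X" "(a, u, b) \<in> W g"
    using assms(1) by (auto simp: inflate_def)
  note c = chart_carrier[OF X *(3)]
  show ?thesis
    using that[OF * c(1,3) _ _ c(2)] chart_carrier[OF monomial_rep_chart(1)[OF rep c(2)] *(4)] by simp
qed

lemma inflate_chart:
  assumes rep: "monomial_rep G H K W" and X: "X \<in> charts G J"
    and inj: "inj_on (case_prod e) (J \<times> K)" and sub: "case_prod e ` (J \<times> K) \<subseteq> I"
  shows "inflate e W X \<in> charts H I"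
proof (rule chartsI)
  fix x u y assume "(x, u, y) \<in> inflate e W X"
  then show "x \<in> I \<and> u \<in> carrier H \<and> y \<in> I"
    using sub by (elim inflateE[OF _ rep X]) auto
next
  fix x u y v z assume "(x, u, y) \<in> inflate e W X" and z: "(x, v, z) \<in> inflate e W X"
  then obtain i g j a b where 1: "x = e i a" "y = e j b" "(i, g, j) \<in> X" "(a, u, b) \<in> W g"
    "i \<in> J" "a \<in> K" "g \<in> carrier G"
    by (elim inflateE[OF _ rep X]) blast
  from z obtain j' b' where z': "z = e j' b'" "j' \<in> J" "b' \<in> K"
    by (elim inflateE[OF _ rep X]) blast
  with z 1 obtain h where "(i, h, j') \<in> X" "(a, v, b') \<in> W h"
    using inflate_iff[OF rep X inj, of i a j' b' v] by auto
  then show "u = v \<and> y = z"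
    using chart_row[OF X 1(3), of h j'] chart_row[OF monomial_rep_chart(1)[OF rep 1(7)] 1(4), of v b']
    by (simp add: 1 z')
next
  fix x u y v z assume "(y, u, x) \<in> inflate e W X" and z: "(z, v, x) \<in> inflate e W X"
  then obtain i g j a b where 1: "y = e i a" "x = e j b" "(i, g, j) \<in> X" "(a, u, b) \<in> W g"
    "j \<in> J" "b \<in> K" "g \<in> carrier G"
    by (elim inflateE[OF _ rep X]) blast
  from z obtain i' a' where z': "z = e i' a'" "i' \<in> J" "a' \<in> K"
    by (elim inflateE[OF _ rep X]) blast
  with z 1 obtain h where "(i', h, j) \<in> X" "(a', v, b) \<in> W h"
    using inflate_iff[OF rep X inj, of i' a' j b v] by auto
  then show "u = v \<and> y = z"
    using chart_col[OF X 1(3), of i' h] chart_col[OF monomial_rep_chart(1)[OF rep 1(7)] 1(4), of a' v]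
    by (simp add: 1 z')
qed

text \<open>
  Block multiplication: two arrows can be composed only if their middle indices lie in the same
  block, so that the underlying arrows of \<open>X\<close> and \<open>Y\<close> can be composed too.
\<close>
lemma inflate_mult:
  assumes rep: "monomial_rep G H K W" and X: "X \<in> charts G J" and Y: "Y \<in> charts G J"
    and inj: "inj_on (case_prod e) (J \<times> K)"
  shows "inflate e W (X \<diamondop>\<^bsub>G\<^esub> Y) = inflate e W X \<diamondop>\<^bsub>H\<^esub> inflate e W Y"
proof (intro equalityI subrelI; clarify)
  fix x w y assume "(x, w, y) \<in> inflate e W (X \<diamondop>\<^bsub>G\<^esub> Y)"
  then obtain i g j a b where 1: "x = e i a" "y = e j b"
    and g: "(i, g, j) \<in> X \<diamondop>\<^bsub>G\<^esub> Y" "(a, w, b) \<in> W g"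
    by (auto simp: inflate_def)
  from g(1) obtain g1 k g2 where 2: "g = g1 \<otimes>\<^bsub>G\<^esub> g2" "(i, g1, k) \<in> X" "(k, g2, j) \<in> Y"
    by (rule chart_multE)
  have "W g = W g1 \<diamondop>\<^bsub>H\<^esub> W g2"
    unfolding 2(1) by (rule monomial_rep_mult[OF rep chart_carrier(2)[OF X 2(2)] chart_carrier(2)[OF Y 2(3)]])
  then obtain u c v where 3: "w = u \<otimes>\<^bsub>H\<^esub> v" "(a, u, c) \<in> W g1" "(c, v, b) \<in> W g2"
    using g(2) by (auto elim: chart_multE)
  have "(x, u, e k c) \<in> inflate e W X" "(e k c, v, y) \<in> inflate e W Y"
    unfolding 1 by (rule inflateI[where W = W, OF 2(2) 3(2)], rule inflateI[where W = W, OF 2(3) 3(3)])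
  then show "(x, w, y) \<in> inflate e W X \<diamondop>\<^bsub>H\<^esub> inflate e W Y"
    unfolding 3(1) by (rule chart_multI)
next
  fix x w y assume "(x, w, y) \<in> inflate e W X \<diamondop>\<^bsub>H\<^esub> inflate e W Y"
  then obtain u z v where w: "w = u \<otimes>\<^bsub>H\<^esub> v"
    and xz: "(x, u, z) \<in> inflate e W X" and zy: "(z, v, y) \<in> inflate e W Y"
    by (rule chart_multE)
  from xz obtain i g k a c where 1: "x = e i a" "z = e k c" "(i, g, k) \<in> X" "(a, u, c) \<in> W g"
    "k \<in> J" "c \<in> K" "g \<in> carrier G"
    by (elim inflateE[OF _ rep X]) blast
  from zy obtain j b where 2: "y = e j b" "j \<in> J" "b \<in> K"
    by (elim inflateE[OF _ rep Y]) blast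
  with zy 1 obtain h where 3: "(k, h, j) \<in> Y" "(c, v, b) \<in> W h"
    using inflate_iff[OF rep Y inj, of k c j b v] by auto
  have "W (g \<otimes>\<^bsub>G\<^esub> h) = W g \<diamondop>\<^bsub>H\<^esub> W h"
    by (rule monomial_rep_mult[OF rep 1(7) chart_carrier(2)[OF Y 3(1)]])
  then have "(a, w, b) \<in> W (g \<otimes>\<^bsub>G\<^esub> h)"
    using chart_multI[OF 1(4) 3(2), of H] by (simp add: w)
  moreover have "(i, g \<otimes>\<^bsub>G\<^esub> h, j) \<in> X \<diamondop>\<^bsub>G\<^esub> Y"
    by (rule chart_multI[OF 1(3) 3(1)])
  ultimately show "(x, w, y) \<in> inflate e W (X \<diamondop>\<^bsub>G\<^esub> Y)"
    unfolding 1(1) 2(1) by (rule inflateI[rotated])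
qed

lemma inflate_disjoint:
  assumes rep: "monomial_rep G H K W" and X: "X \<in> charts G J" and Y: "Y \<in> charts G J"
    and inj: "inj_on (case_prod e) (J \<times> K)"
  shows "row_set X \<inter> row_set Y = {} \<Longrightarrow> row_set (inflate e W X) \<inter> row_set (inflate e W Y) = {}"
    and "col_set X \<inter> col_set Y = {} \<Longrightarrow> col_set (inflate e W X) \<inter> col_set (inflate e W Y) = {}"
proof -
  have row: "\<exists>i a. x = e i a \<and> i \<in> J \<and> a \<in> K \<and> i \<in> row_set Z"
    if "Z \<in> charts G J" "x \<in> row_set (inflate e W Z)" for x Z
    using that by (auto simp: in_rows_iff elim!: inflateE[OF _ rep])
  have col: "\<exists>i a. x = e i a \<and> i \<in> J \<and> a \<in> K \<and> i \<in> col_set Z"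
    if "Z \<in> charts G J" "x \<in> col_set (inflate e W Z)" for x Z
    using that by (auto simp: in_cols_iff elim!: inflateE[OF _ rep])
  have eq: "i = j" if "i \<in> J" "a \<in> K" "j \<in> J" "b \<in> K" "e i a = e j b" for i a j b
    using inj_onD[OF inj, of "(i, a)" "(j, b)"] that by simp
  show "row_set (inflate e W X) \<inter> row_set (inflate e W Y) = {}" if "row_set X \<inter> row_set Y = {}"
  proof (rule equals0I)
    fix x assume "x \<in> row_set (inflate e W X) \<inter> row_set (inflate e W Y)"
    then have x: "x \<in> row_set (inflate e W X)" "x \<in> row_set (inflate e W Y)"
      by simp_all
    obtain i a where i: "x = e i a" "i \<in> J" "a \<in> K" "i \<in> row_set X"
      using row[OF X x(1)] by blast
    obtain j b where j: "x = e j b" "j \<in> J" "b \<in> K" "j \<in> row_set Y"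
      using row[OF Y x(2)] by blast
    have "i = j"
      using i j by (intro eq[of i a j b]) simp_all
    then show False
      using that i(4) j(4) by blast
  qed
  show "col_set (inflate e W X) \<inter> col_set (inflate e W Y) = {}" if "col_set X \<inter> col_set Y = {}"
  proof (rule equals0I)
    fix x assume "x \<in> col_set (inflate e W X) \<inter> col_set (inflate e W Y)"
    then have x: "x \<in> col_set (inflate e W X)" "x \<in> col_set (inflate e W Y)"
      by simp_all
    obtain i a where i: "x = e i a" "i \<in> J" "a \<in> K" "i \<in> col_set X"
      using col[OF X x(1)] by blast
    obtain j b where j: "x = e j b" "j \<in> J" "b \<in> K" "j \<in> col_set Y"
      using col[OF Y x(2)] by blast
    have "i = j"
      using i j by (intro eq[of i a j b]) simp_all
    then show False
      using that i(4) j(4) by blast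
  qed
qed

lemma inflate_Un: "inflate e W (X \<union> Y) = inflate e W X \<union> inflate e W Y"
  and inflate_empty: "inflate e W {} = {}"
  unfolding inflate_def by blast+

text \<open>
  An arrow of \<open>X\<close> labelled \<open>g\<close> produces the whole block \<open>W g\<close>. Its arrows all have to come from the one
  arrow of \<open>Y\<close> at the same position, with label \<open>h\<close> say, so \<open>W g \<subseteq> W h\<close>. Full charts that are comparable
  are equal, and \<open>g = h\<close> follows from faithfulness. A nonempty \<open>K\<close> is needed for the block to contain
  an arrow at all.
\<close>
lemma inflate_subset_imp:
  assumes rep: "monomial_rep G H K W" and X: "X \<in> charts G J" and Y: "Y \<in> charts G J"
    and inj: "inj_on (case_prod e) (J \<times> K)" and "K \<noteq> {}"
    and sub: "inflate e W X \<subseteq> inflate e W Y"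
  shows "X \<subseteq> Y"
proof (intro subrelI; clarify)
  fix i g j assume ij: "(i, g, j) \<in> X"
  note c = chart_carrier[OF X ij]
  have 1: "\<exists>h. (i, h, j) \<in> Y \<and> (a, u, b) \<in> W h" if ab: "(a, u, b) \<in> W g" for a u b
  proof -
    have "a \<in> K" "b \<in> K"
      using chart_carrier[OF monomial_rep_chart(1)[OF rep c(2)] ab] by simp_all
    moreover have "(e i a, u, e j b) \<in> inflate e W Y"
      using sub inflateI[where W = W and e = e, OF ij ab] by blast
    ultimately show ?thesis
      using inflate_iff[OF rep Y inj c(1) _ c(3)] by blast
  qed
  obtain a0 u0 b0 where "(a0, u0, b0) \<in> W g"
    using \<open>K \<noteq> {}\<close> monomial_rep_chart(2)[OF rep c(2)] in_rows_iff[of _ "W g"] by blast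
  then obtain h where h: "(i, h, j) \<in> Y"
    using 1 by blast
  note h_carr = chart_carrier(2)[OF Y h]
  have sub: "W g \<subseteq> W h"
  proof (intro subrelI; clarify)
    fix a u b assume "(a, u, b) \<in> W g"
    then obtain h' where "(i, h', j) \<in> Y" "(a, u, b) \<in> W h'"
      using 1 by blast
    then show "(a, u, b) \<in> W h"
      using chart_row(1)[OF Y h, of h' j] by simp
  qed
  have "W h \<subseteq> W g"
  proof (intro subrelI; clarify)
    fix a u b assume ab: "(a, u, b) \<in> W h"
    then have "a \<in> row_set (W g)"
      using monomial_rep_chart(2)[OF rep c(2)] chart_carrier(1)[OF monomial_rep_chart(1)[OF rep h_carr] ab]
      by simp
    then obtain v d where "(a, v, d) \<in> W g"
      by (auto simp: in_rows_iff)
    then show "(a, u, b) \<in> W g"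
      using sub chart_row[OF monomial_rep_chart(1)[OF rep h_carr] ab, of v d] by auto
  qed
  then have "g = h"
    using sub monomial_rep_inj[OF rep c(2) h_carr] by blast
  then show "(i, g, j) \<in> Y"
    using h by simp
qed

text \<open>
  The embedding is inflation. As joins are only controlled for orthogonal elements, where they are
  unions of charts, its compatibility with joins needs inflated charts to be orthogonal again.
\<close>
lemma embeds_as_bias_if_monomial_rep:
  assumes "chart_semigroup G S J c" and "chart_semigroup H T I d"
    and rep: "monomial_rep G H K W" and "K \<noteq> {}"
    and inj: "inj_on (case_prod e) (J \<times> K)" and sub: "case_prod e ` (J \<times> K) \<subseteq> I"
  shows "embeds_as_bias S T"
proof -
  interpret S: chart_semigroup G S J c by fact
  interpret T: chart_semigroup H T I d by fact
  define f where "f x = T.of_chart (inflate e W (c x))" for x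
  have infl: "inflate e W X \<in> charts H I" if "X \<in> charts G J" for X
    by (rule inflate_chart[OF rep that inj sub])
  have f: "f x \<in> carrier T" "d (f x) = inflate e W (c x)" if "x \<in> carrier S" for x
    using infl[OF S.chart_closed[OF that]]
    by (simp_all add: f_def T.of_chart_closed T.chart_of_chart)
  have orth: "orthogonal T (f x) (f y)"
    if x: "x \<in> carrier S" and y: "y \<in> carrier S" and o: "orthogonal S x y" for x y
  proof -
    have "row_set (c x) \<inter> row_set (c y) = {}" "col_set (c x) \<inter> col_set (c y) = {}"
      using o S.orthogonal_iff[OF x y] by simp_all
    then have "row_set (inflate e W (c x)) \<inter> row_set (inflate e W (c y)) = {}"
      "col_set (inflate e W (c x)) \<inter> col_set (inflate e W (c y)) = {}"
      using inflate_disjoint[OF rep S.chart_closed[OF x] S.chart_closed[OF y] inj] by simp_all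
    then show ?thesis
      using T.orthogonal_iff[of "f x" "f y"] f[OF x] f[OF y] by simp
  qed
  have "bias_hom S T f"
  proof (intro bias_hom.intro bias_hom_axioms.intro)
    show "boolean_inverse_semigroup S" ..
    show "boolean_inverse_semigroup T" ..
    show "f x \<in> carrier T" if "x \<in> carrier S" for x
      using f that by simp
    show "f (x \<star>\<^bsub>S\<^esub> y) = f x \<star>\<^bsub>T\<^esub> f y" if x: "x \<in> carrier S" and y: "y \<in> carrier S" for x y
    proof (rule T.chart_inject[THEN iffD1])
      show "d (f (x \<star>\<^bsub>S\<^esub> y)) = d (f x \<star>\<^bsub>T\<^esub> f y)"
        using inflate_mult[OF rep S.chart_closed[OF x] S.chart_closed[OF y] inj]
        by (simp add: f x y S.prod_closed S.chart_prod T.chart_prod)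
    qed (simp_all add: f x y S.prod_closed T.prod_closed)
    show "f \<^bold>0\<^bsub>S\<^esub> = \<^bold>0\<^bsub>T\<^esub>"
      by (rule T.chart_inject[THEN iffD1])
        (simp_all add: f S.zero_closed T.zero_closed S.chart_zero T.chart_zero inflate_empty)
    show "f (x \<squnion>\<^bsub>natural_order S\<^esub> y) = f x \<squnion>\<^bsub>natural_order T\<^esub> f y"
      if x: "x \<in> carrier S" and y: "y \<in> carrier S" and o: "orthogonal S x y" for x y
      using S.chart_join[OF x y o] T.chart_join[OF f(1)[OF x] f(1)[OF y] orth[OF x y o]]
      by (simp add: f x y inflate_Un flip: T.chart_inject)
  qed
  moreover have "inj_on f (carrier S)"
  proof (rule inj_onI)
    fix x y assume x: "x \<in> carrier S" and y: "y \<in> carrier S" and "f x = f y"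
    then have "inflate e W (c x) = inflate e W (c y)"
      using f(2)[OF x] f(2)[OF y] by simp
    then have "c x = c y"
      using inflate_subset_imp[OF rep S.chart_closed[OF x] S.chart_closed[OF y] inj \<open>K \<noteq> {}\<close>]
        inflate_subset_imp[OF rep S.chart_closed[OF y] S.chart_closed[OF x] inj \<open>K \<noteq> {}\<close>]
      by auto
    then show "x = y"
      using S.chart_inject[OF x y] by simp
  qed
  ultimately show ?thesis
    unfolding embeds_as_bias_def by blast
qed

section \<open>From an embedding to a monomial representation\<close>

definition arrow :: "'i \<Rightarrow> 'g \<Rightarrow> 'i \<Rightarrow> ('i \<times> 'g \<times> 'i) set" where
  "arrow i g j = {(i, g, j)}"

lemma arrow_mult: "arrow i g j \<diamondop>\<^bsub>G\<^esub> arrow k h l = (if j = k then arrow i (g \<otimes>\<^bsub>G\<^esub> h) l else {})"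
  by (auto simp: arrow_def chart_mult_def)

lemma arrow_chart: "\<lbrakk>i \<in> I; g \<in> carrier G; j \<in> I\<rbrakk> \<Longrightarrow> arrow i g j \<in> charts G I"
  by (rule chartsI) (auto simp: arrow_def)

text \<open>
  The sets \<open>A i\<close> are the supports of the images of the diagonal matrix units. Since single arrows are
  invertible relative to these units, the image of an arrow from \<open>i\<close> to \<open>j\<close> is a bijection between
  \<open>A i\<close> and \<open>A j\<close>. Hence the supports have equal size, they are disjoint because distinct diagonal units
  multiply to zero, and the loops at \<open>j0\<close> act on \<open>A j0\<close> by full charts.
\<close>
lemma monomial_rep_if_chart_embedding:
  fixes F :: "('i \<times> 'g \<times> 'i) set \<Rightarrow> ('j \<times> 'h \<times> 'j) set"
  assumes "group G" and "group H" and "finite I" and "finite J" and j0: "j0 \<in> J"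
    and F: "\<And>X. X \<in> charts G J \<Longrightarrow> F X \<in> charts H I"
    and F_mult: "\<And>X Y. \<lbrakk>X \<in> charts G J; Y \<in> charts G J\<rbrakk> \<Longrightarrow> F (X \<diamondop>\<^bsub>G\<^esub> Y) = F X \<diamondop>\<^bsub>H\<^esub> F Y"
    and F_empty: "F {} = {}"
    and F_inj: "inj_on F (charts G J)"
  shows "\<exists>K W. K \<subseteq> I \<and> K \<noteq> {} \<and> card J * card K \<le> card I \<and> monomial_rep G H K W"
proof -
  interpret G: group G by fact
  interpret H: group H by fact
  define A where "A i = row_set (F (arrow i \<one>\<^bsub>G\<^esub> i))" for i
  have FF: "F (arrow i g j) \<diamondop>\<^bsub>H\<^esub> F (arrow j h k) = F (arrow i (g \<otimes>\<^bsub>G\<^esub> h) k)"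
    if "i \<in> J" "j \<in> J" "k \<in> J" "g \<in> carrier G" "h \<in> carrier G" for i j k g h
    using that F_mult[of "arrow i g j" "arrow j h k"] by (simp add: arrow_chart arrow_mult)
  have unit: "F (arrow i \<one>\<^bsub>G\<^esub> i) = unit_chart H (A i)" if i: "i \<in> J" for i
  proof -
    have "F (arrow i \<one>\<^bsub>G\<^esub> i) \<in> charts H I"
      using i by (intro F arrow_chart) simp_all
    moreover have "F (arrow i \<one>\<^bsub>G\<^esub> i) \<diamondop>\<^bsub>H\<^esub> F (arrow i \<one>\<^bsub>G\<^esub> i) = F (arrow i \<one>\<^bsub>G\<^esub> i)"
      using FF[OF i i i, of "\<one>\<^bsub>G\<^esub>" "\<one>\<^bsub>G\<^esub>"] by simp
    ultimately show ?thesis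
      unfolding A_def by (rule H.idempotent_chart_iff[THEN iffD1])
  qed
  have A_sub: "A i \<subseteq> I" if i: "i \<in> J" for i
    using chart_carrier(1)[OF F[OF arrow_chart[of i J "\<one>\<^bsub>G\<^esub>" G i]]] i
    by (auto simp: A_def in_rows_iff)
  have rows: "row_set (F (arrow i g j)) = A i" and cols: "col_set (F (arrow i g j)) = A j"
    if i: "i \<in> J" and j: "j \<in> J" and g: "g \<in> carrier G" for i j g
  proof -
    note g' = G.inv_closed[OF g]
    have "F (arrow i \<one>\<^bsub>G\<^esub> i) = F (arrow i g j) \<diamondop>\<^bsub>H\<^esub> F (arrow j (inv\<^bsub>G\<^esub> g) i)"
      "F (arrow i g j) = F (arrow i \<one>\<^bsub>G\<^esub> i) \<diamondop>\<^bsub>H\<^esub> F (arrow i g j)"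
      using FF[OF i j i g g'] FF[OF i i j G.one_closed g] g by simp_all
    then show "row_set (F (arrow i g j)) = A i"
      unfolding A_def by (metis rows_mult_subset subset_antisym)
    have "F (arrow j \<one>\<^bsub>G\<^esub> j) = F (arrow j (inv\<^bsub>G\<^esub> g) i) \<diamondop>\<^bsub>H\<^esub> F (arrow i g j)"
      "F (arrow i g j) = F (arrow i g j) \<diamondop>\<^bsub>H\<^esub> F (arrow j \<one>\<^bsub>G\<^esub> j)"
      using FF[OF j i j g' g] FF[OF i j j g G.one_closed] g by simp_all
    then have "col_set (F (arrow i g j)) = col_set (F (arrow j \<one>\<^bsub>G\<^esub> j))"
      by (metis cols_mult_subset subset_antisym)
    then show "col_set (F (arrow i g j)) = A j"
      by (simp add: unit[OF j])
  qed
  have card_A: "card (A i) = card (A j0)" if i: "i \<in> J" for i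
    using card_rows_eq_card_cols[OF F[OF arrow_chart[OF i G.one_closed j0]]]
    by (simp add: rows cols i j0)
  have disj: "A i \<inter> A j = {}" if ij: "i \<in> J" "j \<in> J" "i \<noteq> j" for i j
  proof -
    have "unit_chart H (A i) \<diamondop>\<^bsub>H\<^esub> unit_chart H (A j) = {}"
      using ij F_mult[OF arrow_chart[OF ij(1) G.one_closed ij(1)] arrow_chart[OF ij(2) G.one_closed ij(2)]]
      by (simp add: arrow_mult F_empty unit)
    moreover have "(x, \<one>\<^bsub>H\<^esub> \<otimes>\<^bsub>H\<^esub> \<one>\<^bsub>H\<^esub>, x) \<in> unit_chart H (A i) \<diamondop>\<^bsub>H\<^esub> unit_chart H (A j)"
      if "x \<in> A i" "x \<in> A j" for x
      by (rule chart_multI[where k = x]) (simp_all add: unit_chart_iff that)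
    ultimately show ?thesis by blast
  qed
  \<comment> \<open>The disjoint supports fit into \<open>I\<close>.\<close>
  have "card J * card (A j0) = (\<Sum>i\<in>J. card (A i))"
    by (simp add: card_A)
  also have "\<dots> = card (\<Union>i\<in>J. A i)"
    using A_sub disj finite_subset[OF _ \<open>finite I\<close>] \<open>finite J\<close> by (intro card_UN_disjoint[symmetric]) auto
  also have "\<dots> \<le> card I"
    using A_sub by (intro card_mono \<open>finite I\<close>) auto
  finally have card: "card J * card (A j0) \<le> card I" .
  have "A j0 \<noteq> {}"
  proof
    assume "A j0 = {}"
    then have "F (arrow j0 \<one>\<^bsub>G\<^esub> j0) = F {}"
      by (simp add: unit j0 unit_chart_empty F_empty)
    then have "arrow j0 \<one>\<^bsub>G\<^esub> j0 = {}"
      by (rule inj_onD[OF F_inj]) (simp_all add: j0 arrow_chart empty_chart)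
    then show False
      by (simp add: arrow_def)
  qed
  moreover have "monomial_rep G H (A j0) (\<lambda>g. F (arrow j0 g j0))"
    unfolding monomial_rep_def
  proof (intro conjI ballI Pi_I)
    fix g assume g: "g \<in> carrier G"
    note Fg = F[OF arrow_chart[OF j0 g j0]]
    note rc = rows[OF j0 j0 g] cols[OF j0 j0 g]
    have "F (arrow j0 g j0) \<in> charts H (A j0)"
    proof (rule chartsI)
      fix x u y assume *: "(x, u, y) \<in> F (arrow j0 g j0)"
      then have "x \<in> row_set (F (arrow j0 g j0))" "y \<in> col_set (F (arrow j0 g j0))"
        by (auto simp: in_rows_iff in_cols_iff)
      then show "x \<in> A j0 \<and> u \<in> carrier H \<and> y \<in> A j0"
        using rc chart_carrier(2)[OF Fg *] by simp
    qed (use chart_row[OF Fg] chart_col[OF Fg] in auto)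
    then show "F (arrow j0 g j0) \<in> full_charts H (A j0)"
      using rc by (simp add: full_charts_def)
  next
    show "inj_on (\<lambda>g. F (arrow j0 g j0)) (carrier G)"
    proof (rule inj_onI)
      fix g h assume "g \<in> carrier G" "h \<in> carrier G" "F (arrow j0 g j0) = F (arrow j0 h j0)"
      then have "arrow j0 g j0 = arrow j0 h j0"
        using j0 by (intro inj_onD[OF F_inj]) (simp_all add: arrow_chart)
      then show "g = h"
        by (simp add: arrow_def)
    qed
  next
    show "F (arrow j0 (g \<otimes>\<^bsub>G\<^esub> h) j0) = F (arrow j0 g j0) \<diamondop>\<^bsub>H\<^esub> F (arrow j0 h j0)"
      if "g \<in> carrier G" "h \<in> carrier G" for g h
      using FF[OF j0 j0 j0 that] by simp
  qed
  ultimately show ?thesis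
    using A_sub[OF j0] card by (intro exI[of _ "A j0"] exI[of _ "\<lambda>g. F (arrow j0 g j0)"]) simp
qed

text \<open>
  Multiplicativity, preservation of zero and injectivity of the embedding carry over to charts.
\<close>
lemma monomial_rep_if_embeds_as_bias:
  assumes "chart_semigroup G S J c" and "chart_semigroup H T I d"
    and "finite I" and "finite J" and "J \<noteq> {}" and emb: "embeds_as_bias S T"
  shows "\<exists>K W. K \<subseteq> I \<and> K \<noteq> {} \<and> card J * card K \<le> card I \<and> monomial_rep G H K W"
proof -
  interpret S: chart_semigroup G S J c by fact
  interpret T: chart_semigroup H T I d by fact
  obtain f where hom: "bias_hom S T f" and inj: "inj_on f (carrier S)"
    using emb by (auto simp: embeds_as_bias_def)
  interpret f: bias_hom S T f by (rule hom)
  obtain j0 where "j0 \<in> J" using \<open>J \<noteq> {}\<close> by blast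
  let ?F = "\<lambda>X. d (f (S.of_chart X))"
  have oc: "S.of_chart X \<in> carrier S" "f (S.of_chart X) \<in> carrier T" if "X \<in> charts G J" for X
    using that f.hom_closed by (simp_all add: S.of_chart_closed)
  have mult: "S.of_chart (X \<diamondop>\<^bsub>G\<^esub> Y) = S.of_chart X \<star>\<^bsub>S\<^esub> S.of_chart Y"
    if X: "X \<in> charts G J" and Y: "Y \<in> charts G J" for X Y
    using oc(1)[OF X] oc(1)[OF Y] oc(1)[OF S.chart_mult_closed[OF X Y]]
    by (simp add: S.chart_of_chart S.chart_mult_closed S.chart_prod S.prod_closed X Y
        flip: S.chart_inject)
  have zero: "S.of_chart {} = \<^bold>0\<^bsub>S\<^esub>"
    using S.of_chart_chart[OF S.zero_closed] by (simp add: S.chart_zero)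
  have "inj_on ?F (charts G J)"
  proof (rule inj_onI)
    fix X Y assume X: "X \<in> charts G J" and Y: "Y \<in> charts G J" and "?F X = ?F Y"
    then have "f (S.of_chart X) = f (S.of_chart Y)"
      using T.chart_inject[OF oc(2)[OF X] oc(2)[OF Y]] by simp
    then have "S.of_chart X = S.of_chart Y"
      using oc(1)[OF X] oc(1)[OF Y] by (rule inj_onD[OF inj])
    then show "X = Y"
      by (metis S.chart_of_chart[OF X] S.chart_of_chart[OF Y])
  qed
  moreover have "?F X \<in> charts H I" if "X \<in> charts G J" for X
    by (rule T.chart_closed[OF oc(2)[OF that]])
  moreover have "?F (X \<diamondop>\<^bsub>G\<^esub> Y) = ?F X \<diamondop>\<^bsub>H\<^esub> ?F Y" if X: "X \<in> charts G J" and Y: "Y \<in> charts G J" for X Y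
    unfolding mult[OF X Y] f.hom_sprod[OF oc(1)[OF X] oc(1)[OF Y]]
    by (rule T.chart_prod[OF oc(2)[OF X] oc(2)[OF Y]])
  moreover have "?F {} = {}"
    by (simp only: zero f.hom_szero T.chart_zero)
  ultimately show ?thesis
    by (intro monomial_rep_if_chart_embedding[where F = ?F, OF S.is_group T.is_group assms(3,4) \<open>j0 \<in> J\<close>])
qed

lemma floor_of_nat_div: "nat \<lfloor>real n / real m\<rfloor> = n div m"
  by (simp add: floor_divide_of_nat_eq)

theorem lemma7p6:
  fixes G :: "('g, 'c) monoid_scheme" and H :: "('h, 'd) monoid_scheme"
    and m n :: nat
  assumes "group G" and "group H" and "m > 0" and "n > 0"
  shows "embeds_as_bias (rook_semigroup m (group_with_zero G)) (rook_semigroup n (group_with_zero H))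
    \<longleftrightarrow> m \<le> n \<and> mon G (wreath_product H (nat \<lfloor>real n / real m\<rfloor>)) \<noteq> {}"
proof -
  let ?S = "rook_semigroup m (group_with_zero G)" and ?T = "rook_semigroup n (group_with_zero H)"
  let ?k = "n div m"
  note S = group.rook_chart_semigroup[OF \<open>group G\<close>, of m]
  note T = group.rook_chart_semigroup[OF \<open>group H\<close>, of n]
  have "embeds_as_bias ?S ?T \<longleftrightarrow> m \<le> n \<and> (\<exists>W. monomial_rep G H {1..?k} W)"
  proof
    assume "embeds_as_bias ?S ?T"
    then obtain K W where "K \<noteq> {}" and sub: "K \<subseteq> {..<n}" and card: "m * card K \<le> n"
      and W: "monomial_rep G H K W"
      using monomial_rep_if_embeds_as_bias[OF S T] \<open>m > 0\<close> by auto
    have fin: "finite K"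
      using sub finite_subset by blast
    then have "card K > 0"
      using \<open>K \<noteq> {}\<close> by (simp add: card_gt_0_iff)
    then have "m \<le> m * card K"
      by simp
    then have "m \<le> n"
      using card by linarith
    moreover have "card K \<le> card {1..?k}"
      using card \<open>m > 0\<close> by (simp add: less_eq_div_iff_mult_less_eq mult.commute)
    then obtain e where "e ` K \<subseteq> {1..?k}" "inj_on e K"
      using card_le_inj[OF fin finite_atLeastAtMost] by blast
    then have "\<exists>V. monomial_rep G H {1..?k} V"
      using monomial_rep_extend[OF W \<open>group H\<close>] by blast
    ultimately show "m \<le> n \<and> (\<exists>W. monomial_rep G H {1..?k} W)"
      by blast
  next
    assume "m \<le> n \<and> (\<exists>W. monomial_rep G H {1..?k} W)"
    then obtain W where "m \<le> n" and W: "monomial_rep G H {1..?k} W"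
      by blast
    have k: "?k > 0"
      using \<open>m \<le> n\<close> \<open>m > 0\<close> by (simp add: div_greater_zero_iff)
    \<comment> \<open>The indices of block \<open>i\<close> are the \<open>n div m\<close> consecutive ones from \<open>i * (n div m)\<close> on.
      The subtraction is due to the wreath product numbering its coordinates from 1, the matrices their rows from 0.\<close>
    define e where "e i a = i * ?k + (a - 1)" for i a :: nat
    have decode: "e i a div ?k = i \<and> e i a mod ?k = a - 1" if a: "a \<in> {1..?k}" for i a
    proof -
      obtain a' where "a = Suc a'" "a' < ?k"
        using a by (cases a) auto
      then show ?thesis
        by (simp add: e_def)
    qed
    have "inj_on (case_prod e) ({..<m} \<times> {1..?k})"
    proof (rule inj_onI; clarify)
      fix i a j b assume "a \<in> {1..?k}" "b \<in> {1..?k}" "e i a = e j b"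
      then show "i = j \<and> a = b"
        using decode[of a i] decode[of b j] by auto
    qed
    moreover have "e i a < n" if "i < m" "a \<in> {1..?k}" for i a
    proof -
      have "e i a < Suc i * ?k"
        using that by (auto simp: e_def)
      also have "\<dots> \<le> m * ?k"
        using that by (intro mult_right_mono) simp_all
      also have "\<dots> \<le> n"
        by simp
      finally show ?thesis .
    qed
    then have "case_prod e ` ({..<m} \<times> {1..?k}) \<subseteq> {..<n}"
      by auto
    ultimately show "embeds_as_bias ?S ?T"
      using k by (intro embeds_as_bias_if_monomial_rep[OF S T W]) auto
  qed
  also have "(\<exists>W. monomial_rep G H {1..?k} W) \<longleftrightarrow> mon G (wreath_product H ?k) \<noteq> {}"
    by (rule mon_wreath_product_iff[OF \<open>group G\<close> \<open>group H\<close>, symmetric])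
  finally show ?thesis
    unfolding floor_of_nat_div .
qed

end
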